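(* Let $d\ge2$, $\Omega\subset\mathbb R^d$ a bounded polytope, $\mu>0$, $\lambda>0$, $\iota\in(0,1]$, $f\in L^2(\Omega;\mathbb R^d)$, and let $\mathcal T_h$ be a shape-regular simplicial mesh of $\Omega$. Let $(u_h,\eta_h)\in V_h\times\mathbb P_0(\mathring{\mathcal F}_h;\mathbb S)$ solve the hybridized method $$\iota^2\big(\widetilde{\mathcal C}\operatorname{grad}_w(\varepsilon_h(u_h),\eta_h),\operatorname{grad}_w(\varepsilon_h(v_h),\xi_h)\big)+c_h(u_h,v_h)=(f,v_h)\quad\forall\,v_h\in V_h,\ \xi_h\in\mathbb P_0(\mathring{\mathcal F}_h;\mathbb S).$$ Set $\Phi_h:=\iota^2\,\widetilde{\mathcal C}\operatorname{grad}_w(\varepsilon_h(u_h),\eta_h)$. Then $\Phi_h\in\Sigma_h$, and $(\Phi_h,u_h)$ solves the mixed method $$\iota^{-2}(\widetilde{\mathcal A}\Phi_h,\Psi_h)+(\operatorname{div}\Psi_h,\varepsilon_h(u_h))=0\quad\forall\,\Psi_h\in\Sigma_h,$$ $$(\operatorname{div}\Phi_h,\varepsilon_h(v_h))-c_h(u_h,v_h)=-(f,v_h)\quad\forall\,v_h\in V_h.$$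
   Context: Notation. $\mathbb S$: symmetric real $d\times d$ matrices; $I$: identity matrix. $\mathbb S\otimes\mathbb R^d$: third-order tensors with $\Psi_{ijk}=\Psi_{jik}$; $(\tau\otimes v)_{ijk}=\tau_{ij}v_k$; $(\Psi n)_{ij}=\sum_k\Psi_{ijk}n_k$; $\operatorname{tr}(\Psi)_k=\sum_i\Psi_{iik}$; $(\operatorname{div}\Psi)_{ij}=\sum_k\partial_k\Psi_{ijk}$. $(\cdot,\cdot)_D$ is the $L^2(D)$ inner product (Frobenius for tensors), $D=\Omega$ if omitted. $\varepsilon(v)$ is the symmetric gradient, $\sigma(v)=2\mu\varepsilon(v)+\lambda(\operatorname{div}v)I$; $\varepsilon_h,\sigma_h$ are the elementwise versions. $\widetilde{\mathcal A}\Psi=\frac1{2\mu}\big(\Psi-\frac{\lambda}{2\mu+d\lambda}I\otimes\operatorname{tr}(\Psi)\big)$ and its inverse $\widetilde{\mathcal C}\Psi=2\mu\Psi+\lambda I\otimes\operatorname{tr}(\Psi)$. Mesh. $h_F$ is the diameter of the face $F$; $\mathcal F_h$, $\mathring{\mathcal F}_h$ are the sets of all, respectively interior, $(d-1)$-dimensional faces; $n_{\partial T}$ is the outward unit normal of $T$; $n_F$ is a fixed unit normal of $F$ (outward if $F\subset\partial\Omega$). Jump on an interior face $F=T^+\cap T^-$: $[\![v]\!]|_F=v|_{T^+}\,(n_F\cdot n_{\partial T^+})+v|_{T^-}\,(n_F\cdot n_{\partial T^-})$; on a boundary face $[\![v]\!]|_F=v|_F$. $\mathbb P_k(D;\mathbb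 X)$: $\mathbb X$-valued polynomials of degree $\le k$ on $D$. $\mathbb P_0(\mathcal T_h;\mathbb S)$: piecewise constant $\mathbb S$-valued functions; $\mathbb P_0(\mathring{\mathcal F}_h;\mathbb S)$: $\mathbb S$-valued functions on the faces, constant on each face, zero on boundary faces. Spaces. $\Sigma(T;\mathbb S\otimes\mathbb R^d)=\mathbb P_0(T;\mathbb S\otimes\mathbb R^d)+\mathbb P_0(T;\mathbb S)\otimes x$. $\Sigma_h^{-1}=\{\Psi\in L^2(\Omega;\mathbb S\otimes\mathbb R^d):\Psi|_T\in\Sigma(T;\mathbb S\otimes\mathbb R^d)\ \forall T\in\mathcal T_h\}$. $\Sigma_h=\{\Psi\in\Sigma_h^{-1}:$ for each interior face $F$ and $q\in\mathbb P_0(F;\mathbb S)$ the value $(\Psi n_F,q)_F$ is the same from both sides$\}$. $V_h$ (vector Crouzeix–Raviart space) $=\{v\in L^2(\Omega;\mathbb R^d):v|_T\in\mathbb P_1(T;\mathbb R^d)\ \forall T$, $\int_F[\![v]\!]=0\ \forall F\in\mathcal F_h\}$. $M_h=\mathbb P_0(\mathcal T_h;\mathbb S)\times\mathbb P_0(\mathring{\mathcal F}_h;\mathbb S)$. Weak gradient $\operatorname{grad}_w:M_h\to\Sigma_h^{-1}$: for $\tau_h=(\tau_0,\tau_b)\in M_h$, $(\operatorname{grad}_w\tau_h,\Psi)_T=-(\operatorname{div}\Psi,\tau_0)_T+(\Psi n_{\partial T},\tau_b)_{\partial T}$ for all $\Psi\in\Sigma(T;\mathbb S\otimes\mathbb R^d)$,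 $T\in\mathcal T_h$. Form: $c_h(u,v)=(\sigma_h(u),\varepsilon_h(v))+\sum_{F\in\mathcal F_h}h_F^{-1}([\![u]\!],[\![v]\!])_F$. *)

theory Defs
  imports "HOL-Analysis.Analysis"
begin

text \<open>A tensor \<open>\<Psi> :: real^'n^'n^'n\<close> has the components \<open>\<Psi> $ i $ j $ k\<close>. The library inner
  product on nested vector types is the Frobenius product.\<close>

definition Sym :: "(real^'n^'n) set" where
  "Sym = {A. transpose A = A}"

definition Sym3 :: "(real^'n^'n^'n) set" where
  "Sym3 = {\<Psi>. \<forall>i j k. \<Psi> $ i $ j $ k = \<Psi> $ j $ i $ k}"

definition tens :: "real^'n^'n \<Rightarrow> real^'n \<Rightarrow> real^'n^'n^'n" where
  "tens \<tau> v = (\<chi> i j k. \<tau> $ i $ j * v $ k)"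

definition tmulv :: "real^'n^'n^'n \<Rightarrow> real^'n \<Rightarrow> real^'n^'n" where
  "tmulv \<Psi> n = (\<chi> i j. \<Sum>k\<in>UNIV. \<Psi> $ i $ j $ k * n $ k)"

definition ttrace :: "real^'n^'n^'n \<Rightarrow> real^'n" where
  "ttrace \<Psi> = (\<chi> k. \<Sum>i\<in>UNIV. \<Psi> $ i $ i $ k)"

definition Atil :: "real \<Rightarrow> real \<Rightarrow> real^'n^'n^'n \<Rightarrow> real^'n^'n^'n" where
  "Atil \<mu> lam \<Psi> =
     (1 / (2 * \<mu>)) *\<^sub>R (\<Psi> - (lam / (2 * \<mu> + real CARD('n) * lam)) *\<^sub>R tens (mat 1) (ttrace \<Psi>))"

definition Ctil :: "real \<Rightarrow> real \<Rightarrow> real^'n^'n^'n \<Rightarrow> real^'n^'n^'n" where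
  "Ctil \<mu> lam \<Psi> = (2 * \<mu>) *\<^sub>R \<Psi> + lam *\<^sub>R tens (mat 1) (ttrace \<Psi>)"

definition partial :: "'n \<Rightarrow> (real^'n \<Rightarrow> 'b::real_normed_vector) \<Rightarrow> real^'n \<Rightarrow> 'b" where
  "partial k g x = frechet_derivative g (at x) (axis k 1)"

definition sym_grad :: "(real^'n \<Rightarrow> real^'n) \<Rightarrow> real^'n \<Rightarrow> real^'n^'n" where
  "sym_grad v x = (\<chi> i j. (partial j v x $ i + partial i v x $ j) / 2)"

definition div_vec :: "(real^'n \<Rightarrow> real^'n) \<Rightarrow> real^'n \<Rightarrow> real" where
  "div_vec v x = (\<Sum>i\<in>UNIV. partial i v x $ i)"

definition div_tensor :: "(real^'n \<Rightarrow> real^'n^'n^'n) \<Rightarrow> real^'n \<Rightarrow> real^'n^'n" where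
  "div_tensor \<Psi> x = (\<chi> i j. \<Sum>k\<in>UNIV. partial k \<Psi> x $ i $ j $ k)"

definition stress :: "real \<Rightarrow> real \<Rightarrow> (real^'n \<Rightarrow> real^'n) \<Rightarrow> real^'n \<Rightarrow> real^'n^'n" where
  "stress \<mu> lam v x = (2 * \<mu>) *\<^sub>R sym_grad v x + (lam * div_vec v x) *\<^sub>R mat 1"

definition polys :: "nat \<Rightarrow> 'b::real_vector set \<Rightarrow> (real^'n \<Rightarrow> 'b) set" where
  "polys k X = {p. \<exists>c :: ('n \<Rightarrow> nat) \<Rightarrow> 'b. (\<forall>\<alpha>. c \<alpha> \<in> X) \<and>
     p = (\<lambda>x. \<Sum>\<alpha> | (\<Sum>i\<in>UNIV. \<alpha> i) \<le> k. (\<Prod>i\<in>UNIV. x $ i ^ \<alpha> i) *\<^sub>R c \<alpha>)}"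

definition L2 :: "'a::euclidean_space set \<Rightarrow> 'b::euclidean_space set \<Rightarrow> ('a \<Rightarrow> 'b) set" where
  "L2 D X = {f. f \<in> borel_measurable (lebesgue_on D) \<and>
     integrable (lebesgue_on D) (\<lambda>x. (norm (f x))\<^sup>2) \<and> (AE x in lebesgue_on D. f x \<in> X)}"

definition L2_inner ::
    "'a::euclidean_space set \<Rightarrow> ('a \<Rightarrow> 'b::euclidean_space) \<Rightarrow> ('a \<Rightarrow> 'b) \<Rightarrow> real" where
  "L2_inner D f g = (LINT x|lebesgue_on D. inner (f x) (g x))"

text \<open>The \<open>(d-1)\<close>-dimensional Lebesgue measure on a subset \<open>F\<close> of a hyperplane: the slab of total
  thickness one around \<open>F\<close> (half on each side, in normal direction) carries the product of the
  measure of \<open>F\<close> with the length measure of a unit interval, so projecting its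
  \<open>d\<close>-dimensional Lebesgue measure orthogonally onto the hyperplane gives the measure of \<open>F\<close>.\<close>

definition face_slab :: "'a::euclidean_space set \<Rightarrow> 'a set" where
  "face_slab F =
     {x. closest_point (affine hull F) x \<in> F \<and> dist x (closest_point (affine hull F) x) \<le> 1 / 2}"

definition face_measure :: "'a::euclidean_space set \<Rightarrow> 'a measure" where
  "face_measure F = distr (lebesgue_on (face_slab F)) borel (closest_point (affine hull F))"

definition face_inner ::
    "'a::euclidean_space set \<Rightarrow> ('a \<Rightarrow> 'b::euclidean_space) \<Rightarrow> ('a \<Rightarrow> 'b) \<Rightarrow> real" where
  "face_inner F f g = (LINT x|face_measure F. inner (f x) (g x))"

text \<open>A polytope here need not be convex (in contrast to the library's \<open>polytope\<close>): it is an open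
  set lying on both sides of no part of its boundary, whose closure is a finite union of convex
  polytopes.\<close>

definition polytopal_domain :: "'a::euclidean_space set \<Rightarrow> bool" where
  "polytopal_domain \<Omega> \<longleftrightarrow> open \<Omega> \<and> bounded \<Omega> \<and> interior (closure \<Omega>) = \<Omega> \<and>
     (\<exists>\<P>. finite \<P> \<and> (\<forall>P\<in>\<P>. polytope P) \<and> closure \<Omega> = \<Union>\<P>)"

definition simplicial_mesh :: "(real^'n) set \<Rightarrow> (real^'n) set set \<Rightarrow> bool" where
  "simplicial_mesh \<Omega> Th \<longleftrightarrow>
     triangulation Th \<and> (\<forall>T\<in>Th. int CARD('n) simplex T) \<and> \<Union>Th = closure \<Omega>"

definition shape_regular :: "real \<Rightarrow> 'a::euclidean_space set set \<Rightarrow> bool" where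
  "shape_regular \<kappa> Th \<longleftrightarrow>
     (\<forall>T\<in>Th. diameter T \<le> \<kappa> * Sup {2 * r | r x. 0 \<le> r \<and> cball x r \<subseteq> T})"

definition faces :: "'a::euclidean_space set set \<Rightarrow> 'a set set" where
  "faces Th = {F. \<exists>T\<in>Th. F facet_of T}"

definition interior_faces :: "'a::euclidean_space set \<Rightarrow> 'a set set \<Rightarrow> 'a set set" where
  "interior_faces \<Omega> Th = {F \<in> faces Th. \<not> F \<subseteq> frontier \<Omega>}"

text \<open>The (constant) value of the outward unit normal of \<open>T\<close> on its facet \<open>F\<close>.\<close>

definition outward_normal :: "'a::euclidean_space set \<Rightarrow> 'a set \<Rightarrow> 'a" where
  "outward_normal T F = (THE n. norm n = 1 \<and> (\<forall>x\<in>F. \<forall>y\<in>T. inner n (y - x) \<le> 0))"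

definition fixed_normals ::
    "'a::euclidean_space set \<Rightarrow> 'a set set \<Rightarrow> ('a set \<Rightarrow> 'a) \<Rightarrow> bool" where
  "fixed_normals \<Omega> Th nF \<longleftrightarrow> (\<forall>F\<in>faces Th. norm (nF F) = 1 \<and>
     (\<forall>x\<in>F. \<forall>y\<in>F. inner (nF F) (y - x) = 0) \<and>
     (F \<subseteq> frontier \<Omega> \<longrightarrow> (\<forall>T\<in>Th. F facet_of T \<longrightarrow> nF F = outward_normal T F)))"

text \<open>Functions on the domain are taken up to null sets, so \<open>v|T\<close> belongs to a space of polynomials
  in the almost-everywhere sense.\<close>

definition restricts_to :: "(real^'n \<Rightarrow> 'b) \<Rightarrow> (real^'n) set \<Rightarrow> (real^'n \<Rightarrow> 'b) set \<Rightarrow> bool" where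
  "restricts_to v T Q \<longleftrightarrow> (\<exists>p\<in>Q. AE x in lebesgue_on T. v x = p x)"

text \<open>The polynomial that represents \<open>v|T\<close>; its values on the facets of \<open>T\<close> are the traces of \<open>v\<close>
  from the side of \<open>T\<close>. Degree one suffices, since all discrete spaces below are piecewise affine.\<close>

definition piece :: "(real^'n) set \<Rightarrow> (real^'n \<Rightarrow> 'b::real_vector) \<Rightarrow> real^'n \<Rightarrow> 'b" where
  "piece T v = (THE p. p \<in> polys 1 UNIV \<and> (AE x in lebesgue_on T. v x = p x))"

text \<open>The function that is \<open>p T\<close> on the interior of each cell \<open>T\<close> (and \<open>0\<close> on the null set of
  remaining points).\<close>

definition glue :: "(real^'n) set set \<Rightarrow> ((real^'n) set \<Rightarrow> real^'n \<Rightarrow> 'b::zero) \<Rightarrow> real^'n \<Rightarrow> 'b" where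
  "glue Th p x = (if \<exists>T\<in>Th. x \<in> interior T
     then p (THE T. T \<in> Th \<and> x \<in> interior T) x else 0)"

definition eps_h :: "(real^'n) set set \<Rightarrow> (real^'n \<Rightarrow> real^'n) \<Rightarrow> real^'n \<Rightarrow> real^'n^'n" where
  "eps_h Th v = glue Th (\<lambda>T. sym_grad (piece T v))"

definition sigma_h ::
    "real \<Rightarrow> real \<Rightarrow> (real^'n) set set \<Rightarrow> (real^'n \<Rightarrow> real^'n) \<Rightarrow> real^'n \<Rightarrow> real^'n^'n" where
  "sigma_h \<mu> lam Th v = glue Th (\<lambda>T. stress \<mu> lam (piece T v))"

text \<open>On the space \<open>Sigma_h\<close> below the normal components match across interior faces, so there
  the elementwise divergence is the divergence in the sense of distributions.\<close>

definition div_h :: "(real^'n) set set \<Rightarrow> (real^'n \<Rightarrow> real^'n^'n^'n) \<Rightarrow> real^'n \<Rightarrow> real^'n^'n" where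
  "div_h Th \<Psi> = glue Th (\<lambda>T. div_tensor (piece T \<Psi>))"

text \<open>The sum over the cells having \<open>F\<close> as a facet has the two terms \<open>T\<^sup>+\<close>, \<open>T\<^sup>-\<close> for an interior
  face.\<close>

definition jump ::
    "(real^'n) set \<Rightarrow> (real^'n) set set \<Rightarrow> ((real^'n) set \<Rightarrow> real^'n) \<Rightarrow> (real^'n \<Rightarrow> 'b::real_vector)
      \<Rightarrow> (real^'n) set \<Rightarrow> real^'n \<Rightarrow> 'b" where
  "jump \<Omega> Th nF v F x =
     (if F \<subseteq> frontier \<Omega> then piece (THE T. T \<in> Th \<and> F facet_of T) v x
      else (\<Sum>T | T \<in> Th \<and> F facet_of T. inner (nF F) (outward_normal T F) *\<^sub>R piece T v x))"

text \<open>\<open>\<Sigma>(T; S \<otimes> R^d)\<close>, as functions on the whole space: as \<open>T\<close> has interior points, these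
  polynomials are determined by their restriction to \<open>T\<close>.\<close>

definition Sigma_loc :: "(real^'n \<Rightarrow> real^'n^'n^'n) set" where
  "Sigma_loc = {\<lambda>x. A x + tens (\<tau> x) x | A \<tau>. A \<in> polys 0 Sym3 \<and> \<tau> \<in> polys 0 Sym}"

definition Sigma_h_inv ::
    "(real^'n) set \<Rightarrow> (real^'n) set set \<Rightarrow> (real^'n \<Rightarrow> real^'n^'n^'n) set" where
  "Sigma_h_inv \<Omega> Th = {\<Psi> \<in> L2 \<Omega> Sym3. \<forall>T\<in>Th. restricts_to \<Psi> T Sigma_loc}"

definition Sigma_h ::
    "(real^'n) set \<Rightarrow> (real^'n) set set \<Rightarrow> ((real^'n) set \<Rightarrow> real^'n)
      \<Rightarrow> (real^'n \<Rightarrow> real^'n^'n^'n) set" where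
  "Sigma_h \<Omega> Th nF = {\<Psi> \<in> Sigma_h_inv \<Omega> Th.
     \<forall>F\<in>interior_faces \<Omega> Th. \<forall>q\<in>polys 0 Sym. \<forall>T\<in>Th. \<forall>T'\<in>Th. F facet_of T \<longrightarrow> F facet_of T' \<longrightarrow>
       face_inner F (\<lambda>x. tmulv (piece T \<Psi> x) (nF F)) q =
       face_inner F (\<lambda>x. tmulv (piece T' \<Psi> x) (nF F)) q}"

definition V_h ::
    "(real^'n) set \<Rightarrow> (real^'n) set set \<Rightarrow> ((real^'n) set \<Rightarrow> real^'n) \<Rightarrow> (real^'n \<Rightarrow> real^'n) set" where
  "V_h \<Omega> Th nF = {v \<in> L2 \<Omega> UNIV. (\<forall>T\<in>Th. restricts_to v T (polys 1 UNIV)) \<and>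
     (\<forall>F\<in>faces Th. (LINT x|face_measure F. jump \<Omega> Th nF v F x) = 0)}"

text \<open>A function on the faces that is constant on each face is given by its value on each face.\<close>

definition P0_int_faces ::
    "(real^'n) set \<Rightarrow> (real^'n) set set \<Rightarrow> ((real^'n) set \<Rightarrow> real^'n^'n) set" where
  "P0_int_faces \<Omega> Th = {\<xi>. (\<forall>F\<in>faces Th. \<xi> F \<in> Sym) \<and> (\<forall>F\<in>faces Th - interior_faces \<Omega> Th. \<xi> F = 0)}"

definition grad_w_loc ::
    "(real^'n) set \<Rightarrow> (real^'n \<Rightarrow> real^'n^'n) \<Rightarrow> ((real^'n) set \<Rightarrow> real^'n^'n)
      \<Rightarrow> real^'n \<Rightarrow> real^'n^'n^'n" where
  "grad_w_loc T \<tau>0 \<tau>b = (THE G. G \<in> Sigma_loc \<and> (\<forall>\<Psi>\<in>Sigma_loc.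
     L2_inner T G \<Psi> = - L2_inner T (div_tensor \<Psi>) \<tau>0 +
       (\<Sum>F | F facet_of T. face_inner F (\<lambda>x. tmulv (\<Psi> x) (outward_normal T F)) (\<lambda>_. \<tau>b F))))"

definition grad_w ::
    "(real^'n) set set \<Rightarrow> (real^'n \<Rightarrow> real^'n^'n) \<Rightarrow> ((real^'n) set \<Rightarrow> real^'n^'n)
      \<Rightarrow> real^'n \<Rightarrow> real^'n^'n^'n" where
  "grad_w Th \<tau>0 \<tau>b = glue Th (\<lambda>T. grad_w_loc T \<tau>0 \<tau>b)"

definition c_h ::
    "real \<Rightarrow> real \<Rightarrow> (real^'n) set \<Rightarrow> (real^'n) set set \<Rightarrow> ((real^'n) set \<Rightarrow> real^'n)
      \<Rightarrow> (real^'n \<Rightarrow> real^'n) \<Rightarrow> (real^'n \<Rightarrow> real^'n) \<Rightarrow> real" where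
  "c_h \<mu> lam \<Omega> Th nF u v = L2_inner \<Omega> (sigma_h \<mu> lam Th u) (eps_h Th v) +
     (\<Sum>F\<in>faces Th. (1 / diameter F) * face_inner F (jump \<Omega> Th nF u F) (jump \<Omega> Th nF v F))"

end

theory Submission
  imports Defs
begin

text \<open>Both methods encode the same integration by parts. Summing the cellwise definition of the
  weak gradient of \<open>(eps_h v, \<xi>)\<close>, tested with a piecewise \<open>\<Psi>\<close>, gives
  \<open>(\<Psi>, grad_w (eps_h v, \<xi>)) = - (div_h \<Psi>, eps_h v) + (\<Sum>T. \<Sum>F. (\<Psi>\<^sub>T n\<^sub>T, \<xi>)\<^sub>F)\<close>,
  where \<open>F\<close> ranges over the facets of \<open>T\<close> (\<open>weak_gradient_by_parts\<close>).
  Regrouped by faces, the double sum pairs the data \<open>\<xi>\<close> with the jumps of the normal component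
  of \<open>\<Psi>\<close>: an interior face lies in exactly two cells, with opposite outward normals, and the data
  vanish on the other faces. Hence the sum vanishes for all \<open>\<xi>\<close> exactly when \<open>\<Psi>\<close> is normally
  continuous (\<open>Sigma_h_face_sum\<close>, \<open>Sigma_hI\<close>).

  The three claims follow. The constitutive tensor maps the local space to itself
  (\<open>Ctil_Sigma_loc\<close>), so \<open>\<Phi>\<close> is piecewise in that space. Varying \<open>\<xi>\<close> alone in the hybridized
  equation shows that the face sum of \<open>\<Phi>\<close> is zero, which is normal continuity. Taking \<open>\<xi> = 0\<close> and
  applying the identity to \<open>\<Phi>\<close> turns the hybridized equation into the second mixed equation. For the
  first one, \<open>Atil\<close> undoes \<open>Ctil\<close>, so \<open>Atil \<mu> lam \<circ> \<Phi>\<close> is \<open>\<iota>\<^sup>2\<close> times the weak gradient, and the face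
  sum of a normally continuous \<open>\<Psi>\<close> against \<open>\<eta>\<close> drops out.

  Two preparations make the identity meaningful. Local weak gradients exist and are unique by a
  finite-dimensional Riesz argument (\<open>grad_w_loc_spec\<close>). The combinatorics of faces rests on the fact
  that near a relative interior point of a facet a simplex is a half ball: two cells on the same side
  of a common facet would overlap (\<open>cells_at_shared_facet\<close>), and a face that meets \<open>\<Omega>\<close> has a cell on
  its other side (\<open>interior_face_shared\<close>).\<close>

section \<open>Polynomials of degree at most one\<close>

lemma polys_0: "polys 0 X = {\<lambda>_::real^'n. c | c. c \<in> X}" (is "_ = ?R")
proof
  have S: "{\<alpha> :: 'n \<Rightarrow> nat. (\<Sum>i\<in>UNIV. \<alpha> i) \<le> 0} = {\<lambda>_. 0}" by auto
  show "polys 0 X \<subseteq> ?R" unfolding polys_def S by auto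
  show "?R \<subseteq> polys 0 X"
  proof
    fix p assume "p \<in> ?R"
    then obtain c where c: "c \<in> X" "p = (\<lambda>_. c)" by auto
    then show "p \<in> polys 0 X"
      unfolding polys_def S by (auto intro!: exI[of _ "\<lambda>_. c"])
  qed
qed

text \<open>The monomials of degree at most one are the constant and the coordinates. This turns the
  sum over exponents in \<open>polys 1\<close> into an explicit affine expression.\<close>

lemma exponents_le_1:
  "{\<alpha> :: 'n::finite \<Rightarrow> nat. (\<Sum>i\<in>UNIV. \<alpha> i) \<le> 1} = insert (\<lambda>_. 0) (range (\<lambda>i j. if j = i then 1 else 0))"
    (is "?A = ?B")
proof
  show "?A \<subseteq> ?B"
  proof
    fix \<alpha> assume a: "\<alpha> \<in> ?A"
    show "\<alpha> \<in> ?B"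
    proof (cases "\<forall>i. \<alpha> i = 0")
      case True
      then show ?thesis by auto
    next
      case False
      then obtain i where i: "\<alpha> i \<noteq> 0" by auto
      have "(\<Sum>i\<in>UNIV. \<alpha> i) = \<alpha> i + (\<Sum>i\<in>UNIV - {i}. \<alpha> i)"
        by (simp add: sum.remove)
      moreover have "(\<Sum>i\<in>UNIV. \<alpha> i) \<le> 1" "\<alpha> i \<ge> 1" using a i by auto
      ultimately have ai: "\<alpha> i = 1" and "(\<Sum>i\<in>UNIV - {i}. \<alpha> i) = 0" by linarith+
      then have "\<forall>j\<in>UNIV - {i}. \<alpha> j = 0" by (subst (asm) sum_eq_0_iff) auto
      with ai have "\<alpha> = (\<lambda>j. if j = i then 1 else 0)" by (auto simp: fun_eq_iff)
      then show ?thesis by blast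
    qed
  qed
  show "?B \<subseteq> ?A" by (auto simp: sum.delta)
qed

lemma sum_exponents_le_1:
  fixes x :: "real^'n" and c :: "('n \<Rightarrow> nat) \<Rightarrow> 'b::real_vector"
  shows "(\<Sum>\<alpha> | (\<Sum>i\<in>UNIV. \<alpha> i) \<le> 1. (\<Prod>i\<in>UNIV. x $ i ^ \<alpha> i) *\<^sub>R c \<alpha>) =
    c (\<lambda>_. 0) + (\<Sum>k\<in>UNIV. x $ k *\<^sub>R c (\<lambda>j. if j = k then 1 else 0))"
proof -
  let ?e = "\<lambda>(i::'n) j. if j = i then 1 else (0::nat)"
  have inj: "inj ?e" by (auto simp: inj_def fun_eq_iff split: if_splits)
  have n0: "(\<lambda>_. 0) \<notin> range ?e" by (auto simp: fun_eq_iff) (metis zero_neq_one)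
  have p: "(\<Prod>i\<in>UNIV. x $ i ^ ?e k i) = x $ k" for k
  proof -
    have "(\<Prod>i\<in>UNIV. x $ i ^ ?e k i) = (\<Prod>i\<in>UNIV. if i = k then x $ i else 1)"
      by (rule prod.cong) auto
    then show ?thesis by (simp add: prod.delta)
  qed
  show ?thesis
    unfolding exponents_le_1
    using n0 by (subst sum.insert) (auto simp: sum.reindex[OF inj] p)
qed

lemma polys_1_iff:
  fixes p :: "real^'n \<Rightarrow> 'b::real_vector"
  shows "p \<in> polys 1 UNIV \<longleftrightarrow> (\<exists>L c. linear L \<and> p = (\<lambda>x. L x + c))"
proof
  assume "p \<in> polys 1 UNIV"
  then obtain c :: "('n \<Rightarrow> nat) \<Rightarrow> 'b"
    where c: "p = (\<lambda>x. c (\<lambda>_. 0) + (\<Sum>k\<in>UNIV. x $ k *\<^sub>R c (\<lambda>j. if j = k then 1 else 0)))"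
    unfolding polys_def sum_exponents_le_1 by (auto simp only: mem_Collect_eq)
  have "linear (\<lambda>x::real^'n. \<Sum>k\<in>UNIV. x $ k *\<^sub>R c (\<lambda>j. if j = k then 1 else 0))"
    by (rule linearI) (auto simp: scaleR_left_distrib sum.distrib scaleR_sum_right)
  moreover have "p = (\<lambda>x. (\<Sum>k\<in>UNIV. x $ k *\<^sub>R c (\<lambda>j. if j = k then 1 else 0)) + c (\<lambda>_. 0))"
    unfolding c by (simp only: add.commute)
  ultimately show "\<exists>L c. linear L \<and> p = (\<lambda>x. L x + c)" by blast
next
  assume "\<exists>L c. linear L \<and> p = (\<lambda>x. L x + c)"
  then obtain L c where L: "linear L" and p: "p = (\<lambda>x. L x + c)" by auto
  define cc where "cc = (\<lambda>\<alpha> :: 'n \<Rightarrow> nat. if \<alpha> = (\<lambda>_. 0) then c else L (axis (THE k. \<alpha> k = 1) 1))"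
  have c0: "cc (\<lambda>_. 0) = c" by (simp add: cc_def)
  have ck: "cc (\<lambda>j. if j = k then 1 else 0) = L (axis k 1)" for k
    by (auto simp: cc_def fun_eq_iff)
  have Lx: "(\<Sum>k\<in>UNIV. x $ k *\<^sub>R L (axis k 1)) = L x" for x
  proof -
    have "L x = L (\<Sum>k\<in>UNIV. x $ k *\<^sub>R axis k 1)"
      using basis_expansion[of x] by (simp add: scalar_mult_eq_scaleR)
    then show ?thesis by (simp add: linear_sum[OF L] linear_cmul[OF L])
  qed
  show "p \<in> polys 1 UNIV"
    unfolding polys_def sum_exponents_le_1 p
    by (intro CollectI exI[of _ cc]) (simp add: c0 ck Lx add.commute)
qed

text \<open>Around a point of the open set, agreement at \<open>x0\<close> and at \<open>x0 + t *\<^sub>R v\<close> for one \<open>t > 0\<close>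
  forces the linear parts to agree at \<open>v\<close>. This is what makes the trace of a piecewise affine
  function from a given cell well defined.\<close>

lemma affine_polys_eq_on_open:
  fixes p q :: "real^'n \<Rightarrow> 'b::real_vector"
  assumes "p \<in> polys 1 UNIV" "q \<in> polys 1 UNIV" "open U" "x0 \<in> U" and eq: "\<And>x. x \<in> U \<Longrightarrow> p x = q x"
  shows "p = q"
proof -
  obtain L c M d where L: "linear L" "p = (\<lambda>x. L x + c)" and M: "linear M" "q = (\<lambda>x. M x + d)"
    using assms polys_1_iff by metis
  obtain r where r: "r > 0" "ball x0 r \<subseteq> U" using assms openE by blast
  have LM: "L v = M v" for v
  proof -
    \<comment> \<open>This keeps \<open>x0 + t *\<^sub>R v\<close> inside the ball, also for \<open>v = 0\<close>.\<close>
    define t where "t = r / (2 * (norm v + 1))"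
    have t: "t > 0" using r by (simp add: t_def add_nonneg_pos)
    have "norm (t *\<^sub>R v) \<le> r / 2 * (norm v / (norm v + 1))" using r by (simp add: t_def)
    also have "\<dots> \<le> r / 2 * 1"
      using r by (intro mult_left_mono) (auto simp: divide_le_eq add_nonneg_pos)
    finally have "x0 + t *\<^sub>R v \<in> U" using r by (intro subsetD[OF r(2)]) (auto simp: dist_norm)
    then have "L x0 + t *\<^sub>R L v + c = M x0 + t *\<^sub>R M v + d" "L x0 + c = M x0 + d"
      using eq[of "x0 + t *\<^sub>R v"] eq[of x0] \<open>x0 \<in> U\<close> L M
      by (auto simp: linear_add linear_cmul)
    then have "t *\<^sub>R L v = t *\<^sub>R M v" by (metis add.assoc add.commute add_left_cancel)
    then show ?thesis using t by simp
  qed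
  moreover have "c = d" using eq[OF \<open>x0 \<in> U\<close>] LM L M by auto
  ultimately show ?thesis using L M by auto
qed

lemma affine_poly_continuous:
  fixes p :: "real^'n \<Rightarrow> 'b::real_normed_vector"
  assumes "p \<in> polys 1 UNIV"
  shows "continuous_on S p"
proof -
  obtain L c where "linear L" "p = (\<lambda>x. L x + c)" using assms polys_1_iff by blast
  then show ?thesis
    by (simp add: linear_conv_bounded_linear linear_continuous_on continuous_on_add)
qed

lemma partial_affine:
  fixes L :: "real^'n \<Rightarrow> 'b::real_normed_vector"
  assumes "linear L"
  shows "partial k (\<lambda>x. L x + c) x = L (axis k 1)"
proof -
  have "((\<lambda>x. L x + c) has_derivative L) (at x)"
    using assms by (auto intro!: derivative_eq_intros bounded_linear_imp_has_derivative simp: linear_conv_bounded_linear)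
  then show ?thesis
    unfolding partial_def by (metis frechet_derivative_at)
qed

lemma sym_grad_affine_constant:
  assumes "p \<in> polys 1 UNIV"
  shows "\<exists>e. \<forall>x. sym_grad p x = e"
  using assms unfolding polys_1_iff sym_grad_def by (auto simp: partial_affine)

section \<open>The local tensor space and the constitutive tensor\<close>

lemma tens_linear_right: "linear (tens \<tau>)"
  by (rule linearI) (auto simp: tens_def vec_eq_iff algebra_simps)

lemma tens_add_left: "tens (\<tau> + \<tau>') x = tens \<tau> x + tens \<tau>' x"
  by (auto simp: tens_def vec_eq_iff algebra_simps)

lemma tens_scaleR_left: "tens (c *\<^sub>R \<tau>) x = c *\<^sub>R tens \<tau> x"
  by (auto simp: tens_def vec_eq_iff algebra_simps)

lemma linear_tmulv: "linear (\<lambda>A. tmulv A n)"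
  by (rule linearI)
    (auto simp: tmulv_def vec_eq_iff algebra_simps sum.distrib sum_distrib_left)

lemma tmulv_scaleR_right: "tmulv A (c *\<^sub>R n) = c *\<^sub>R tmulv A n"
  by (auto simp: tmulv_def vec_eq_iff algebra_simps sum.distrib sum_distrib_left)

text \<open>The elements of \<open>Sigma_loc\<close> are functions; parametrising them by their two coefficients
  moves questions about the local space to a subspace of a Euclidean space, where dimension
  arguments are available.\<close>

definition sigma_fun :: "(real^'n^'n^'n) \<times> (real^'n^'n) \<Rightarrow> real^'n \<Rightarrow> real^'n^'n^'n" where
  "sigma_fun p x = fst p + tens (snd p) x"

lemma Sigma_loc_eq: "Sigma_loc = sigma_fun ` (Sym3 \<times> Sym)"
proof
  show "Sigma_loc \<subseteq> sigma_fun ` (Sym3 \<times> Sym)"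
    unfolding Sigma_loc_def polys_0 by (force simp: sigma_fun_def fun_eq_iff image_iff)
  show "sigma_fun ` (Sym3 \<times> Sym) \<subseteq> Sigma_loc"
  proof
    fix f assume "f \<in> sigma_fun ` (Sym3 \<times> Sym)"
    then obtain A \<tau> where "A \<in> Sym3" "\<tau> \<in> Sym" "f = sigma_fun (A, \<tau>)" by auto
    then show "f \<in> Sigma_loc"
      unfolding Sigma_loc_def polys_0
      by (auto intro!: exI[of _ "\<lambda>_. A"] exI[of _ "\<lambda>_. \<tau>"] simp: sigma_fun_def fun_eq_iff)
  qed
qed

lemma sigma_fun_polys_1: "sigma_fun p \<in> polys 1 UNIV"
  unfolding polys_1_iff
  by (intro exI[of _ "tens (snd p)"] exI[of _ "fst p"])
    (auto simp: tens_linear_right sigma_fun_def fun_eq_iff)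

lemma Sigma_loc_polys_1: "p \<in> Sigma_loc \<Longrightarrow> p \<in> polys 1 UNIV"
  unfolding Sigma_loc_eq using sigma_fun_polys_1 by auto

lemma sigma_fun_linear: "linear (\<lambda>p. sigma_fun p x)"
  by (rule linearI) (auto simp: sigma_fun_def tens_add_left tens_scaleR_left algebra_simps)

text \<open>The value at \<open>0\<close> is the constant coefficient, and the entry \<open>(i, j, i)\<close> of
  \<open>tens \<tau> (axis i 1)\<close> is \<open>\<tau> $ i $ j\<close>, so the two coefficients can be read off.\<close>

lemma sigma_fun_eq_0:
  assumes "sigma_fun p = (\<lambda>_. 0)"
  shows "p = 0"
proof -
  have "fst p + tens (snd p) 0 = 0" using fun_cong[OF assms, of 0] by (simp add: sigma_fun_def)
  then have f: "fst p = 0" by (simp add: linear_0[OF tens_linear_right])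
  have t: "tens (snd p) x = 0" for x using fun_cong[OF assms, of x] f by (simp add: sigma_fun_def)
  have "snd p = 0"
  proof (subst vec_eq_iff, safe, subst vec_eq_iff, safe)
    fix i j
    have "tens (snd p) (axis i 1) $ i $ j $ i = 0" using t by simp
    then show "snd p $ i $ j = 0 $ i $ j" by (simp add: tens_def axis_def)
  qed
  with f show ?thesis by (simp add: prod_eq_iff)
qed

lemma div_sigma_fun:
  "div_tensor (sigma_fun p :: real^'n \<Rightarrow> _) = (\<lambda>_. real CARD('n) *\<^sub>R snd p)"
proof -
  have "sigma_fun p = (\<lambda>x. tens (snd p) x + fst p)" by (auto simp: sigma_fun_def)
  then have "partial k (sigma_fun p) x = tens (snd p) (axis k 1)" for k x
    by (metis partial_affine tens_linear_right)
  then show ?thesis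
    by (simp add: div_tensor_def fun_eq_iff vec_eq_iff tens_def axis_def)
qed

lemma subspace_Sym: "subspace Sym"
  by (auto simp: subspace_def Sym_def transpose_def vec_eq_iff)

lemma subspace_Sym3: "subspace Sym3"
  by (auto simp: subspace_def Sym3_def)

lemma Sym_mat_1: "mat 1 \<in> Sym"
  by (simp add: Sym_def)

lemma tens_Sym3: "\<tau> \<in> Sym \<Longrightarrow> tens \<tau> v \<in> Sym3"
  by (auto simp: Sym_def Sym3_def tens_def transpose_def vec_eq_iff)

lemma Sigma_loc_Sym3: "p \<in> Sigma_loc \<Longrightarrow> p x \<in> Sym3"
  unfolding Sigma_loc_eq sigma_fun_def
  by (auto intro!: subspace_add[OF subspace_Sym3] tens_Sym3)

lemma ttrace_tens: "ttrace (tens \<tau> x) = trace \<tau> *\<^sub>R x"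
  by (auto simp: ttrace_def tens_def vec_eq_iff trace_def sum_distrib_right)

lemma linear_ttrace: "linear ttrace"
  by (rule linearI) (auto simp: ttrace_def vec_eq_iff sum.distrib sum_distrib_left)

lemma linear_Ctil: "linear (Ctil \<mu> lam)"
  by (rule linearI)
    (auto simp: Ctil_def linear_add[OF linear_ttrace] linear_cmul[OF linear_ttrace]
      linear_add[OF tens_linear_right] linear_cmul[OF tens_linear_right] algebra_simps)

text \<open>Since \<open>I \<otimes> tr (\<tau> \<otimes> x) = (tr \<tau>) I \<otimes> x\<close>, the constitutive tensor maps each of the two
  summands of the local space into itself. Hence \<open>\<Phi>\<close> is again piecewise in that space.\<close>

lemma Ctil_Sigma_loc:
  assumes "p \<in> Sigma_loc"
  shows "(\<lambda>x. c *\<^sub>R Ctil \<mu> lam (p x)) \<in> Sigma_loc"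
proof -
  obtain A \<tau> where A: "A \<in> Sym3" "\<tau> \<in> Sym" and p: "p = sigma_fun (A, \<tau>)"
    using assms unfolding Sigma_loc_eq by auto
  let ?\<tau> = "c *\<^sub>R ((2 * \<mu>) *\<^sub>R \<tau> + (lam * trace \<tau>) *\<^sub>R mat 1)"
  have t: "Ctil \<mu> lam (tens \<tau> x) = tens ((2 * \<mu>) *\<^sub>R \<tau> + (lam * trace \<tau>) *\<^sub>R mat 1) x" for x
    by (simp add: Ctil_def ttrace_tens tens_add_left tens_scaleR_left linear_cmul[OF tens_linear_right])
  have "(\<lambda>x. c *\<^sub>R Ctil \<mu> lam (p x)) = sigma_fun (c *\<^sub>R Ctil \<mu> lam A, ?\<tau>)"
    by (simp only: p sigma_fun_def fun_eq_iff linear_add[OF linear_Ctil] t tens_scaleR_left scaleR_right_distrib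
        fst_conv snd_conv) (simp add: tens_add_left tens_scaleR_left scaleR_right_distrib)
  moreover have "c *\<^sub>R Ctil \<mu> lam A \<in> Sym3"
    unfolding Ctil_def using A
    by (intro subspace_scale[OF subspace_Sym3] subspace_add[OF subspace_Sym3] tens_Sym3 Sym_mat_1)
  moreover have "?\<tau> \<in> Sym"
    using A by (intro subspace_scale[OF subspace_Sym] subspace_add[OF subspace_Sym] Sym_mat_1)
  ultimately show ?thesis unfolding Sigma_loc_eq by blast
qed

text \<open>As \<open>tr I = d\<close>, taking the trace of \<open>Ctil \<mu> lam \<Psi>\<close> multiplies the trace of \<open>\<Psi>\<close> by
  \<open>2 \<mu> + d lam\<close>, which is nonzero for positive parameters.\<close>

lemma Atil_Ctil:
  fixes \<Psi> :: "real^'n^'n^'n"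
  assumes "0 < \<mu>" "0 < lam"
  shows "Atil \<mu> lam (Ctil \<mu> lam \<Psi>) = \<Psi>"
proof -
  let ?d = "real CARD('n)"
  have pos: "2 * \<mu> + ?d * lam > 0" using assms by (simp add: add_pos_pos)
  have tr: "ttrace (Ctil \<mu> lam \<Psi>) = (2 * \<mu> + ?d * lam) *\<^sub>R ttrace \<Psi>"
    by (simp add: Ctil_def linear_add[OF linear_ttrace] linear_cmul[OF linear_ttrace] ttrace_tens
        trace_I algebra_simps)
  have "(lam / (2 * \<mu> + ?d * lam)) *\<^sub>R tens (mat 1) (ttrace (Ctil \<mu> lam \<Psi>)) = lam *\<^sub>R tens (mat 1) (ttrace \<Psi>)"
    unfolding tr linear_cmul[OF tens_linear_right] using pos by simp
  then show ?thesis
    unfolding Atil_def using assms by (simp add: Ctil_def)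
qed

lemma linear_Atil: "linear (Atil \<mu> lam)"
  by (rule linearI)
    (auto simp: Atil_def linear_add[OF linear_ttrace] linear_cmul[OF linear_ttrace]
      linear_add[OF tens_linear_right] linear_cmul[OF tens_linear_right] algebra_simps)

section \<open>Facets and outward normals\<close>

text \<open>A set of dimension \<open>d - 1\<close> spans a hyperplane, and the part of \<open>b\<close> orthogonal to \<open>a\<close> is a
  direction of that hyperplane, hence orthogonal to \<open>b\<close> as well and so zero.\<close>

lemma unit_normal_unique_up_to_sign:
  fixes F :: "'a::euclidean_space set"
  assumes F: "F \<noteq> {}" "aff_dim F = int DIM('a) - 1"
    and a: "norm a = 1" "\<And>x y. x \<in> F \<Longrightarrow> y \<in> F \<Longrightarrow> inner a (y - x) = 0"
    and b: "norm b = 1" "\<And>x y. x \<in> F \<Longrightarrow> y \<in> F \<Longrightarrow> inner b (y - x) = 0"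
  shows "b = a \<or> b = - a"
proof -
  obtain x0 where x0: "x0 \<in> F" using F by auto
  have hyp: "affine hull F = {x. inner n x = inner n x0}"
    if n: "norm n = 1" "\<And>x y. x \<in> F \<Longrightarrow> y \<in> F \<Longrightarrow> inner n (y - x) = 0" for n
  proof (rule affine_dim_equal)
    show "affine hull F \<subseteq> {x. inner n x = inner n x0}"
      using n(2)[OF x0] by (intro hull_minimal) (auto simp: affine_hyperplane inner_diff_right)
    show "aff_dim (affine hull F) = aff_dim {x. inner n x = inner n x0}"
      using n F by (subst aff_dim_hyperplane) auto
  qed (use F in \<open>auto simp: affine_hyperplane\<close>)
  define w where "w = b - inner a b *\<^sub>R a"
  have aw: "inner a w = 0" using a by (simp add: w_def inner_diff_right norm_eq_1)
  moreover have ha: "affine hull F = {x. inner a x = inner a x0}" by (rule hyp) (use a in auto)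
  moreover have hb: "affine hull F = {x. inner b x = inner b x0}" by (rule hyp) (use b in auto)
  ultimately have "x0 + w \<in> {x. inner b x = inner b x0}" by (auto simp: inner_add_right)
  then have "inner b w = 0" by (simp add: inner_add_right)
  then have "inner w w = 0" using aw by (subst (1) w_def) (simp add: inner_diff_left)
  then have ba: "b = inner a b *\<^sub>R a" by (simp add: w_def)
  then have "\<bar>inner a b\<bar> = 1" using a b by (metis mult.right_neutral norm_scaleR)
  with ba show ?thesis by (auto simp: abs_if split: if_splits)
qed

definition full_polytope :: "'a::euclidean_space set \<Rightarrow> bool" where
  "full_polytope T \<longleftrightarrow> polytope T \<and> aff_dim T = int DIM('a)"

lemma full_polytopeD:
  assumes "full_polytope T"
  shows "convex T" "compact T" "closed T" "interior T \<noteq> {}" "polytope T" "T \<in> sets lebesgue"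
proof -
  show "convex T" "compact T" "closed T" "polytope T"
    using assms polytope_imp_convex polytope_imp_compact polytope_imp_closed by (auto simp: full_polytope_def)
  then show "T \<in> sets lebesgue" by (simp add: borel_closed)
  have "T \<noteq> {}" using assms by (auto simp: full_polytope_def)
  then show "interior T \<noteq> {}"
    using \<open>convex T\<close> assms by (simp add: interior_rel_interior_gen full_polytope_def rel_interior_eq_empty)
qed

lemma facet_of_full_polytope:
  assumes "full_polytope T" "F facet_of T"
  shows "F \<noteq> {}" "F \<subseteq> T" "aff_dim F = int DIM('a) - 1" "convex F" "compact F" "F face_of (T :: 'a::euclidean_space set)"
  using assms full_polytopeD[OF assms(1)] unfolding full_polytope_def facet_of_def
  by (auto simp: face_of_imp_convex face_of_imp_compact dest: face_of_imp_subset)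

text \<open>A facet of a polytope is cut out by a supporting hyperplane, whose normalised normal
  satisfies the description of the outward normal. Any other candidate is this vector or its
  opposite, and the opposite is excluded by the interior points of the polytope.\<close>

lemma outward_normal_facet:
  fixes T :: "'a::euclidean_space set"
  assumes "full_polytope T" "F facet_of T"
  shows "norm (outward_normal T F) = 1"
    and "\<And>x y. x \<in> F \<Longrightarrow> y \<in> T \<Longrightarrow> inner (outward_normal T F) (y - x) \<le> 0"
    and "\<And>x y. x \<in> F \<Longrightarrow> y \<in> interior T \<Longrightarrow> inner (outward_normal T F) (y - x) < 0"
    and "\<And>x y. x \<in> F \<Longrightarrow> y \<in> F \<Longrightarrow> inner (outward_normal T F) (y - x) = 0"
proof -
  note T = full_polytopeD[OF assms(1)] and F = facet_of_full_polytope[OF assms]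
  have perp: "inner n (y - x) = 0"
    if "\<forall>x\<in>F. \<forall>y\<in>T. inner n (y - x) \<le> 0" "x \<in> F" "y \<in> F" for n x y
  proof -
    have "inner n (y - x) \<le> 0" "inner n (x - y) \<le> 0" using that F by blast+
    then show ?thesis by (simp add: inner_diff_right)
  qed
  have inside: "inner n (y - x) < 0"
    if n: "norm n = 1" "\<forall>x\<in>F. \<forall>y\<in>T. inner n (y - x) \<le> 0" and x: "x \<in> F" and y: "y \<in> interior T" for n x y
  proof -
    obtain r where r: "r > 0" "cball y r \<subseteq> T" using y by (meson mem_interior_cball)
    \<comment> \<open>An interior point can still be displaced by \<open>r\<close> along \<open>n\<close> within \<open>T\<close>, which makes the inequality strict.\<close>
    have "y + r *\<^sub>R n \<in> T" using r n by (intro subsetD[OF r(2)]) (auto simp: dist_norm)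
    then have "inner n (y + r *\<^sub>R n - x) \<le> 0" using n x by blast
    moreover have "inner n n = 1" using n(1) by (simp add: norm_eq_1)
    ultimately show ?thesis using r by (simp add: inner_diff_right inner_add_right)
  qed
  have "F \<noteq> T" using assms facet_of_irrefl by blast
  moreover have "F exposed_face_of T"
    using F T exposed_face_of_polyhedron polytope_imp_polyhedron by blast
  ultimately obtain a b where ab: "a \<noteq> 0" "T \<subseteq> {x. inner a x \<le> b}" "F = T \<inter> {x. inner a x = b}"
    using F(1) unfolding exposed_face_of by blast
  let ?n = "a /\<^sub>R norm a"
  have ex: "norm ?n = 1 \<and> (\<forall>x\<in>F. \<forall>y\<in>T. inner ?n (y - x) \<le> 0)"
    using ab by (auto simp: inner_diff_right field_simps)
  have uniq: "n = ?n" if n: "norm n = 1 \<and> (\<forall>x\<in>F. \<forall>y\<in>T. inner n (y - x) \<le> 0)" for n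
  proof -
    have "n = ?n \<or> n = - ?n"
      using ex n perp by (intro unit_normal_unique_up_to_sign[OF F(1,3)]) blast+
    moreover obtain x y where "x \<in> F" "y \<in> interior T" using T F by blast
    then have "inner n (y - x) < 0" "inner ?n (y - x) < 0" using inside n ex by blast+
    ultimately show ?thesis by auto
  qed
  have eq: "outward_normal T F = ?n"
    unfolding outward_normal_def using ex uniq by (rule the_equality)
  show "norm (outward_normal T F) = 1"
    and "\<And>x y. x \<in> F \<Longrightarrow> y \<in> T \<Longrightarrow> inner (outward_normal T F) (y - x) \<le> 0"
    and "\<And>x y. x \<in> F \<Longrightarrow> y \<in> interior T \<Longrightarrow> inner (outward_normal T F) (y - x) < 0"
    and "\<And>x y. x \<in> F \<Longrightarrow> y \<in> F \<Longrightarrow> inner (outward_normal T F) (y - x) = 0"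
    unfolding eq using ex inside perp by blast+
qed

lemma facet_affine_hull:
  fixes T :: "'a::euclidean_space set"
  assumes "full_polytope T" "F facet_of T" "y \<in> F"
  shows "{x. inner (outward_normal T F) x = inner (outward_normal T F) y} \<subseteq> affine hull F"
proof -
  let ?n = "outward_normal T F"
  note F = facet_of_full_polytope[OF assms(1,2)] and n = outward_normal_facet[OF assms(1,2)]
  have "affine hull F = {x. inner ?n x = inner ?n y}"
  proof (rule affine_dim_equal)
    show "affine hull F \<subseteq> {x. inner ?n x = inner ?n y}"
      using n(4)[OF assms(3)] by (intro hull_minimal) (auto simp: affine_hyperplane inner_diff_right)
    show "aff_dim (affine hull F) = aff_dim {x. inner ?n x = inner ?n y}"
      using n(1) F by (subst aff_dim_hyperplane) auto
  qed (use F in \<open>auto simp: affine_hyperplane\<close>)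
  then show ?thesis by simp
qed

text \<open>Near a relative interior point of a facet the polytope fills a half ball. Given an inward
  direction \<open>v\<close>, subtract the multiple of \<open>z - y\<close>, for an interior point \<open>z\<close>, with the same
  normal component: the remainder \<open>w\<close> is tangential, so a short step along \<open>w\<close> stays in the
  facet, and \<open>y + t *\<^sub>R v\<close> is a convex combination of such a facet point and \<open>z\<close>.\<close>

lemma inward_ray_stays_inside:
  fixes T :: "'a::euclidean_space set"
  assumes "full_polytope T" "F facet_of T" and y: "y \<in> rel_interior F" and v: "inner (outward_normal T F) v < 0"
  shows "\<exists>d>0. \<forall>t. 0 < t \<and> t < d \<longrightarrow> y + t *\<^sub>R v \<in> T"
proof -
  let ?n = "outward_normal T F"
  note T = full_polytopeD[OF assms(1)] and F = facet_of_full_polytope[OF assms(1,2)] and n = outward_normal_facet[OF assms(1,2)]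
  obtain e where yF: "y \<in> F" and e: "e > 0" "ball y e \<inter> affine hull F \<subseteq> F"
    using y by (auto simp: mem_rel_interior_ball)
  obtain z where z: "z \<in> interior T" using T by blast
  then have zT: "z \<in> T" using interior_subset by blast
  have nz: "inner ?n (z - y) < 0" using n(3) yF z by blast
  \<comment> \<open>\<open>c\<close> is chosen so that \<open>v - c *\<^sub>R (z - y)\<close> is tangential to the facet.\<close>
  define c where "c = inner ?n v / inner ?n (z - y)"
  have c: "c > 0" using nz v by (simp add: c_def divide_neg_neg)
  define w where "w = v - c *\<^sub>R (z - y)"
  have nw: "inner ?n w = 0" unfolding w_def c_def using nz by (simp add: inner_diff_right)
  \<comment> \<open>The first bound keeps the weight \<open>c * t\<close> of \<open>z\<close> below one half, the second keeps the tangential step within the facet.\<close>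
  define d where "d = min (1 / (2 * c)) (e / (2 * (norm w + 1)))"
  have "d > 0" using c e by (simp add: d_def add_nonneg_pos)
  moreover have "y + t *\<^sub>R v \<in> T" if t: "0 < t" "t < d" for t
  proof -
    have ct: "c * t < 1 / 2" using t c by (auto simp: d_def field_simps)
    define s where "s = t / (1 - c * t)"
    have s: "0 < s" "s \<le> 2 * t" using ct t by (auto simp: s_def field_simps)
    have "norm (s *\<^sub>R w) \<le> 2 * t * norm w" using s by (simp add: mult_right_mono)
    also have "\<dots> \<le> 2 * t * (norm w + 1)" using t by (simp add: mult_left_mono)
    also have "\<dots> < e" using t 
      using pos_less_divide_eq[of "2 * (norm w + 1)" t e] by (simp add: d_def add_nonneg_pos mult_ac)
    finally have "y + s *\<^sub>R w \<in> ball y e" by (simp add: dist_norm)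
    moreover have "y + s *\<^sub>R w \<in> affine hull F"
      using facet_affine_hull[OF assms(1,2) yF] nw by (auto simp: inner_add_right)
    ultimately have "y + s *\<^sub>R w \<in> T" using e F by blast
    then have "(1 - c * t) *\<^sub>R (y + s *\<^sub>R w) + (c * t) *\<^sub>R z \<in> T"
      using T zT ct c t by (intro convexD) auto
    moreover have "(1 - c * t) *\<^sub>R (y + s *\<^sub>R w) + (c * t) *\<^sub>R z = y + t *\<^sub>R v"
    proof -
      have "(1 - c * t) *\<^sub>R s *\<^sub>R w = t *\<^sub>R w" using ct by (simp add: s_def)
      then show ?thesis by (simp add: w_def algebra_simps)
    qed
    ultimately show ?thesis by simp
  qed
  ultimately show ?thesis by blast
qed

text \<open>Both polytopes contain a half ball on the same side of the common facet.\<close>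

lemma same_side_interiors_meet:
  fixes T T' :: "'a::euclidean_space set"
  assumes "full_polytope T" "full_polytope T'" "F facet_of T" "F facet_of T'"
    and n: "outward_normal T F = outward_normal T' F"
  shows "interior T \<inter> T' \<noteq> {}"
proof -
  note T = full_polytopeD[OF assms(1)] and F = facet_of_full_polytope[OF assms(1,3)]
  obtain y where y: "y \<in> rel_interior F" using F by (metis rel_interior_eq_empty ex_in_conv)
  then have yF: "y \<in> F" using rel_interior_subset by blast
  obtain z where z: "z \<in> interior T" using T by blast
  have "inner (outward_normal T' F) (z - y) < 0"
    using outward_normal_facet(3)[OF assms(1,3) yF z] n by simp
  then obtain d where d: "d > 0" "\<And>t. 0 < t \<Longrightarrow> t < d \<Longrightarrow> y + t *\<^sub>R (z - y) \<in> T'"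
    using inward_ray_stays_inside[OF assms(2,4) y] by blast
  define t where "t = min (d / 2) 1"
  have t: "0 < t" "t < d" "t \<le> 1" using d by (auto simp: t_def)
  have "y - t *\<^sub>R (y - z) \<in> interior T"
    using mem_interior_convex_shrink[OF T(1) z _ t(1,3)] yF F by blast
  moreover have "y - t *\<^sub>R (y - z) = y + t *\<^sub>R (z - y)" by (simp add: algebra_simps)
  ultimately show ?thesis using d(2)[OF t(1,2)] by auto
qed

section \<open>Adjacency of cells\<close>

lemma mesh_cells:
  assumes "simplicial_mesh \<Omega> (Th :: (real^'n) set set)"
  shows "finite Th" "\<And>T. T \<in> Th \<Longrightarrow> full_polytope T" "\<Union>Th = closure \<Omega>"
    "\<And>T T'. T \<in> Th \<Longrightarrow> T' \<in> Th \<Longrightarrow> (T \<inter> T') face_of T"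
  using assms
  by (auto simp: simplicial_mesh_def triangulation_def full_polytope_def dest: aff_dim_simplex simplex_imp_polytope)

text \<open>A proper face misses the interior, so the common face \<open>T \<inter> T'\<close> is all of \<open>T\<close>; then \<open>T\<close> is
  a face of \<open>T'\<close> of the same dimension.\<close>

lemma cells_eqI:
  assumes m: "simplicial_mesh \<Omega> (Th :: (real^'n) set set)" and TT: "T \<in> Th" "T' \<in> Th"
    and meet: "interior T \<inter> T' \<noteq> {}"
  shows "T = T'"
proof (rule ccontr)
  assume ne: "T \<noteq> T'"
  note c = mesh_cells[OF m]
  have i: "T \<inter> T' = T"
  proof (rule ccontr)
    assume "T \<inter> T' \<noteq> T"
    then have "(T \<inter> T') \<inter> interior T = {}" using c(4)[OF TT] face_of_disjoint_interior by blast
    then show False using meet interior_subset by blast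
  qed
  have "T face_of T'" using c(4)[OF TT(2,1)] i by (simp add: Int_commute)
  then have "aff_dim T < aff_dim T'"
    using c(2) TT ne full_polytopeD(1) by (intro face_of_aff_dim_lt) auto
  then show False using c(2) TT by (auto simp: full_polytope_def)
qed

text \<open>The two normals are orthogonal to the same hyperplane, and equal normals would put both
  cells on the same side.\<close>

lemma shared_facet_opposite_normals:
  assumes m: "simplicial_mesh \<Omega> (Th :: (real^'n) set set)" and TT: "T \<in> Th" "T' \<in> Th" "T \<noteq> T'"
    and F: "F facet_of T" "F facet_of T'"
  shows "outward_normal T' F = - outward_normal T F"
proof -
  note c = mesh_cells[OF m]
  note s = c(2)[OF TT(1)] c(2)[OF TT(2)]
  have "outward_normal T' F = outward_normal T F \<or> outward_normal T' F = - outward_normal T F"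
    using outward_normal_facet(1,4)[OF s(1) F(1)] outward_normal_facet(1,4)[OF s(2) F(2)]
    by (intro unit_normal_unique_up_to_sign[OF facet_of_full_polytope(1,3)[OF s(1) F(1)]]) auto
  moreover have "outward_normal T F \<noteq> outward_normal T' F"
    using same_side_interiors_meet[OF s F] cells_eqI[OF m TT(1,2)] TT(3) by blast
  ultimately show ?thesis by auto
qed

text \<open>A hyperplane has only two sides: a third cell would share its outward normal with one of
  the other two.\<close>

lemma cells_at_shared_facet:
  assumes m: "simplicial_mesh \<Omega> (Th :: (real^'n) set set)" and TT: "T \<in> Th" "T' \<in> Th" "T \<noteq> T'"
    and F: "F facet_of T" "F facet_of T'"
  shows "{T'' \<in> Th. F facet_of T''} = {T, T'}"
proof -
  note c = mesh_cells[OF m]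
  have False if T'': "T'' \<in> Th" "F facet_of T''" "T'' \<noteq> T" "T'' \<noteq> T'" for T''
  proof -
    have "outward_normal T'' F = outward_normal T' F"
      using shared_facet_opposite_normals[OF m TT F]
        shared_facet_opposite_normals[OF m TT(1) T''(1) _ F(1) T''(2)] T'' by auto
    then show False
      using same_side_interiors_meet[OF c(2) c(2) T''(2) F(2)] cells_eqI[OF m T''(1) TT(2)] TT T'' by blast
  qed
  then show ?thesis using TT F by blast
qed

text \<open>Take a relative interior point \<open>y\<close> of the face that lies in \<open>\<Omega>\<close> and move a little outwards
  from the cell \<open>T\<close>. The point reached lies in a second cell, which contains \<open>y\<close> if the step
  avoids the finitely many closed cells that do not contain \<open>y\<close>. The intersection of the two
  cells is a face of \<open>T\<close> meeting the relative interior of \<open>F\<close>, so it contains \<open>F\<close>, and by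
  dimension it equals \<open>F\<close>.\<close>

lemma interior_face_shared:
  assumes m: "simplicial_mesh \<Omega> (Th :: (real^'n) set set)" and dom: "polytopal_domain \<Omega>"
    and F: "F \<in> interior_faces \<Omega> Th"
  obtains T T' where "T \<in> Th" "T' \<in> Th" "T \<noteq> T'" "F facet_of T" "F facet_of T'"
proof -
  note c = mesh_cells[OF m]
  obtain T where T: "T \<in> Th" "F facet_of T" and nf: "\<not> F \<subseteq> frontier \<Omega>"
    using F by (auto simp: interior_faces_def faces_def)
  have op: "open \<Omega>" using dom by (simp add: polytopal_domain_def)
  note sT = c(2)[OF T(1)]
  note fT = facet_of_full_polytope[OF sT T(2)] and n = outward_normal_facet[OF sT T(2)]
  let ?n = "outward_normal T F"
  obtain x where x: "x \<in> F" "x \<notin> frontier \<Omega>" using nf by blast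
  then have "x \<in> closure \<Omega>" using fT T c(3) by blast
  then have "x \<in> \<Omega>" using x op by (simp add: frontier_def interior_open)
  then have "\<Omega> \<inter> closure (rel_interior F) \<noteq> {}"
    using x fT convex_closure_rel_interior[of F] closure_subset[of F] by blast
  then obtain y where y: "y \<in> \<Omega>" "y \<in> rel_interior F"
    using open_Int_closure_eq_empty[OF op] by blast
  then have yF: "y \<in> F" using rel_interior_subset by blast
  \<comment> \<open>Any cell that meets \<open>U\<close> contains \<open>y\<close>.\<close>
  define U where "U = \<Omega> - \<Union>{T'\<in>Th. y \<notin> T'}"
  have "open U"
    unfolding U_def using op c(1) c(2) full_polytopeD(3) by (intro open_Diff closed_Union) auto
  moreover have "y \<in> U" using y by (auto simp: U_def)
  ultimately obtain r where r: "r > 0" "cball y r \<subseteq> U" by (meson open_contains_cball)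
  have "y + r *\<^sub>R ?n \<in> U" using r n(1) by (intro subsetD[OF r(2)]) (auto simp: dist_norm)
  then obtain T' where T': "T' \<in> Th" "y + r *\<^sub>R ?n \<in> T'" "y \<in> T'"
    using c(3) closure_subset[of \<Omega>] unfolding U_def by blast
  have ne: "T \<noteq> T'"
  proof
    assume "T = T'"
    then have "inner ?n (y + r *\<^sub>R ?n - y) \<le> 0" using n(2) yF T' by blast
    moreover have "inner ?n ?n = 1" using n(1) by (simp add: norm_eq_1)
    ultimately show False using r by simp
  qed
  have face: "(T \<inter> T') face_of T" "(T \<inter> T') face_of T'"
    using c(4)[OF T(1) T'(1)] c(4)[OF T'(1) T(1)] by (auto simp: Int_commute)
  have FI: "F \<subseteq> T \<inter> T'"
    using subset_of_face_of[OF face(1) fT(2)] y yF fT T' by blast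
  have neT: "T \<inter> T' \<noteq> T"
  proof
    assume "T \<inter> T' = T"
    then have "interior T \<subseteq> T'" using interior_subset by blast
    then show False using cells_eqI[OF m T(1) T'(1)] ne full_polytopeD(4)[OF sT] by blast
  qed
  have "F = T \<inter> T'"
  proof (rule ccontr)
    assume "F \<noteq> T \<inter> T'"
    moreover have "F face_of (T \<inter> T')" using face_of_subset[OF fT(6) FI] by blast
    moreover have "convex (T \<inter> T')" using face face_of_imp_convex by blast
    ultimately have "aff_dim F < aff_dim (T \<inter> T')" using face_of_aff_dim_lt by blast
    moreover have "aff_dim (T \<inter> T') < aff_dim T"
      using face_of_aff_dim_lt[OF full_polytopeD(1)[OF sT] face(1) neT] .
    ultimately show False using T(2) by (simp add: facet_of_def)
  qed
  then have "F facet_of T'"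
    using face fT c(2)[OF T'(1)] by (auto simp: facet_of_def full_polytope_def)
  with that T T' ne show ?thesis by blast
qed

lemma fixed_normal_sign:
  assumes m: "simplicial_mesh \<Omega> (Th :: (real^'n) set set)" and nF: "fixed_normals \<Omega> Th nF"
    and T: "T \<in> Th" "F facet_of T"
  shows "\<exists>s. (s = 1 \<or> s = -1) \<and> outward_normal T F = s *\<^sub>R nF F"
proof -
  note s = mesh_cells(2)[OF m T(1)]
  have "F \<in> faces Th" using T by (auto simp: faces_def)
  then have "norm (nF F) = 1" "\<And>x y. x \<in> F \<Longrightarrow> y \<in> F \<Longrightarrow> inner (nF F) (y - x) = 0"
    using nF by (auto simp: fixed_normals_def)
  then have "outward_normal T F = nF F \<or> outward_normal T F = - nF F"
    using outward_normal_facet(1,4)[OF s T(2)]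
    by (intro unit_normal_unique_up_to_sign[OF facet_of_full_polytope(1,3)[OF s T(2)]]) auto
  then show ?thesis by (metis scaleR_minus1_left scaleR_one)
qed

lemma finite_faces:
  assumes "simplicial_mesh \<Omega> (Th :: (real^'n) set set)"
  shows "finite (faces Th)"
proof -
  have "faces Th = (\<Union>T\<in>Th. {F. F facet_of T})" by (auto simp: faces_def)
  then show ?thesis
    using mesh_cells(1,2)[OF assms] by (auto intro!: finite_polytope_facets full_polytopeD(5))
qed

section \<open>Integration over cells and faces\<close>

text \<open>Functions in the discrete spaces are known only up to null sets; the measurability of
  their polynomial pieces passes to them because Lebesgue measure is complete.\<close>

lemma borel_measurable_lebesgue_on_AE:
  fixes f g :: "'a::euclidean_space \<Rightarrow> 'b::topological_space"
  assumes S: "S \<in> sets lebesgue" and f: "f \<in> borel_measurable (lebesgue_on S)"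
    and eq: "AE x in lebesgue_on S. f x = g x"
  shows "g \<in> borel_measurable (lebesgue_on S)"
proof (rule measurableI)
  fix A :: "'b set" assume A: "A \<in> sets borel"
  have fA: "f -` A \<inter> S \<in> sets lebesgue"
    using measurable_sets[OF f A] S by (simp add: sets_restrict_space_iff)
  have ae: "AE x in lebesgue. x \<in> f -` A \<inter> S \<longleftrightarrow> x \<in> g -` A \<inter> S"
    using eq S by (auto simp: AE_restrict_space_iff elim!: eventually_mono)
  have "g -` A \<inter> S \<in> sets lebesgue"
    using completion.in_sets_AE[OF ae fA] by simp
  then show "g -` A \<inter> space (lebesgue_on S) \<in> sets (lebesgue_on S)"
    using S by (simp add: sets_restrict_space_iff)
qed simp

lemma AE_sym: "AE x in M. f x = g x \<Longrightarrow> AE x in M. g x = f x"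
  by (auto elim: eventually_mono)

lemma integrable_lebesgue_on_AE:
  fixes f g :: "'a::euclidean_space \<Rightarrow> 'b::euclidean_space"
  assumes S: "S \<in> sets lebesgue" and eq: "AE x in lebesgue_on S. f x = g x"
    and f: "integrable (lebesgue_on S) f"
  shows "integrable (lebesgue_on S) g"
  using f borel_measurable_lebesgue_on_AE[OF S borel_measurable_integrable[OF f] eq] eq
  by (rule integrable_cong_AE_imp)

lemma integral_lebesgue_on_AE:
  fixes f g :: "'a::euclidean_space \<Rightarrow> 'b::euclidean_space"
  assumes S: "S \<in> sets lebesgue" and eq: "AE x in lebesgue_on S. f x = g x"
  shows "integral\<^sup>L (lebesgue_on S) f = integral\<^sup>L (lebesgue_on S) g"
proof (cases "integrable (lebesgue_on S) f")
  case True
  then show ?thesis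
    using integrable_lebesgue_on_AE[OF S eq True] eq by (intro integral_cong_AE) auto
next
  case False
  then have "\<not> integrable (lebesgue_on S) g"
    using integrable_lebesgue_on_AE[OF S AE_sym[OF eq]] by blast
  with False show ?thesis by (simp add: not_integrable_integral_eq)
qed

lemma L2_inner_cong_AE:
  assumes "S \<in> sets lebesgue" "AE x in lebesgue_on S. f x = f' x" "AE x in lebesgue_on S. g x = g' x"
  shows "L2_inner S f g = L2_inner S f' g'"
  unfolding L2_inner_def using assms by (intro integral_lebesgue_on_AE) (auto elim: eventually_elim2)

lemma integrable_lebesgue_on_compact:
  fixes f :: "'a::euclidean_space \<Rightarrow> 'b::euclidean_space"
  assumes "compact S" "continuous_on S f"
  shows "integrable (lebesgue_on S) f"
proof -
  have S: "S \<in> sets lebesgue" using assms by (simp add: borel_compact)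
  have b: "integrable lborel (\<lambda>x. indicator S x *\<^sub>R f x)" by (rule borel_integrable_compact[OF assms])
  then have "integrable lebesgue (\<lambda>x. indicator S x *\<^sub>R f x)"
    by (subst integrable_completion) (auto intro: borel_measurable_integrable)
  then show ?thesis using S by (subst integrable_restrict_space) auto
qed

lemma integrable_iff_absolutely:
  fixes f :: "'a::euclidean_space \<Rightarrow> 'b::euclidean_space"
  assumes "S \<in> sets lebesgue"
  shows "integrable (lebesgue_on S) f \<longleftrightarrow> f absolutely_integrable_on S"
  using assms by (simp add: integrable_restrict_space set_integrable_def)

lemma AE_full_polytope_interior:
  assumes "full_polytope T" "\<And>x. x \<in> interior T \<Longrightarrow> P x"
  shows "AE x in lebesgue_on T. P x"
proof -
  note T = full_polytopeD[OF assms(1)]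
  have "frontier T \<in> null_sets lebesgue"
    using negligible_convex_frontier[OF T(1)] by (simp add: negligible_iff_null_sets)
  then have "AE x in lebesgue. x \<in> T \<longrightarrow> P x"
    by (rule AE_I') (use assms(2) T(3) in \<open>auto simp: frontier_def\<close>)
  then show ?thesis using T(6) by (simp add: AE_restrict_space_iff)
qed

text \<open>The points of disagreement in the interior form an open null set, which must be empty.\<close>

lemma continuous_AE_eq_on_interior:
  fixes f g :: "'a::euclidean_space \<Rightarrow> 'b::real_normed_vector"
  assumes "full_polytope T" "continuous_on UNIV f" "continuous_on UNIV g"
    and ae: "AE x in lebesgue_on T. f x = g x" and x: "x \<in> interior T"
  shows "f x = g x"
proof (rule ccontr)
  assume ne: "f x \<noteq> g x"
  note T = full_polytopeD[OF assms(1)]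
  let ?U = "interior T \<inter> {x. f x \<noteq> g x}"
  have "AE x in lebesgue. x \<in> T \<longrightarrow> f x = g x"
    using ae T(6) by (simp add: AE_restrict_space_iff)
  then have "{x. \<not> (x \<in> T \<longrightarrow> f x = g x)} \<in> null_sets lebesgue"
    by (simp add: completion.AE_iff_null_sets)
  then have "negligible {x. \<not> (x \<in> T \<longrightarrow> f x = g x)}" by (simp add: negligible_iff_null_sets)
  then have "negligible ?U"
    by (rule negligible_subset) (use interior_subset in auto)
  moreover have "open ?U"
    using assms by (intro open_Int open_Collect_neq) auto
  ultimately show False using open_not_negligible x ne by blast
qed

lemma affine_polys_eq_AE:
  fixes p q :: "real^'n \<Rightarrow> 'b::real_normed_vector"
  assumes "full_polytope T" "p \<in> polys 1 UNIV" "q \<in> polys 1 UNIV" "AE x in lebesgue_on T. p x = q x"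
  shows "p = q"
proof -
  obtain x0 where "x0 \<in> interior T" using full_polytopeD(4)[OF assms(1)] by blast
  then show ?thesis
    using continuous_AE_eq_on_interior[OF assms(1) _ _ assms(4)] assms affine_poly_continuous
    by (intro affine_polys_eq_on_open[OF assms(2,3) open_interior]) blast+
qed

lemma piece_eq:
  fixes v p :: "real^'n \<Rightarrow> 'b::real_normed_vector"
  assumes "full_polytope T" "p \<in> polys 1 UNIV" "AE x in lebesgue_on T. v x = p x"
  shows "piece T v = p"
  unfolding piece_def
proof (rule the_equality)
  fix q assume q: "q \<in> polys 1 UNIV \<and> (AE x in lebesgue_on T. v x = q x)"
  with assms(3) have "AE x in lebesgue_on T. q x = p x" by (auto elim: eventually_elim2)
  then show "q = p" using affine_polys_eq_AE[OF assms(1)] q assms(2) by blast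
qed (use assms in auto)

text \<open>The frontier of \<open>\<Omega>\<close> lies in the union of the frontiers of the cells, and two distinct
  cells meet in frontier points only. All of these sets are null, because the frontier of a
  convex set is.\<close>

lemma mesh_integral:
  fixes g :: "real^'n \<Rightarrow> 'b::euclidean_space"
  assumes m: "simplicial_mesh \<Omega> Th" and dom: "polytopal_domain \<Omega>"
    and g: "\<And>T. T \<in> Th \<Longrightarrow> integrable (lebesgue_on T) g"
  shows "integrable (lebesgue_on \<Omega>) g"
    and "integral\<^sup>L (lebesgue_on \<Omega>) g = (\<Sum>T\<in>Th. integral\<^sup>L (lebesgue_on T) g)"
proof -
  note c = mesh_cells[OF m]
  have op: "open \<Omega>" "interior (closure \<Omega>) = \<Omega>" using dom by (auto simp: polytopal_domain_def)
  then have \<Omega>: "\<Omega> \<in> sets lebesgue" by auto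
  have "frontier \<Omega> \<subseteq> (\<Union>T\<in>Th. frontier T)"
  proof
    fix x assume "x \<in> frontier \<Omega>"
    then have x: "x \<in> closure \<Omega>" "x \<notin> \<Omega>" using op by (auto simp: frontier_def interior_open)
    then obtain T where T: "T \<in> Th" "x \<in> T" using c(3) by blast
    have "x \<notin> interior T"
      using x(2) op(2) c(3) T(1) interior_mono[of T "closure \<Omega>"] by blast
    then show "x \<in> (\<Union>T\<in>Th. frontier T)" using T closure_subset by (fastforce simp: frontier_def)
  qed
  moreover have "negligible (\<Union>T\<in>Th. frontier T)"
    using c by (intro negligible_Union) (auto intro: negligible_convex_frontier full_polytopeD)
  ultimately have neg: "negligible (frontier \<Omega>)" by (rule negligible_subset[rotated])
  have spike: "negligible {x \<in> closure \<Omega> - \<Omega>. g x \<noteq> 0}" "negligible {x \<in> \<Omega> - closure \<Omega>. g x \<noteq> 0}"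
    using op closure_subset[of \<Omega>] by (auto intro!: negligible_subset[OF neg] simp: frontier_def interior_open)
  have ab: "g absolutely_integrable_on T" if "T \<in> Th" for T
    using g c(2) that full_polytopeD(6) integrable_iff_absolutely by blast
  have "g absolutely_integrable_on \<Union>A" if "A \<subseteq> Th" for A
    using finite_subset[OF that c(1)] that
  proof (induction A rule: finite_induct)
    case (insert T A)
    then show ?case using ab by (simp add: absolutely_integrable_Un)
  qed simp
  then have "g absolutely_integrable_on closure \<Omega>" using c(3) by force
  then have "g absolutely_integrable_on \<Omega>"
    using absolutely_integrable_spike_set_eq[OF spike] by blast
  then show I: "integrable (lebesgue_on \<Omega>) g" using \<Omega> integrable_iff_absolutely by blast
  have "(g has_integral (\<Sum>T\<in>Th. integral\<^sup>L (lebesgue_on T) g)) (\<Union>Th)"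
  proof (rule has_integral_Union[OF c(1)])
    show "(g has_integral integral\<^sup>L (lebesgue_on T) g) T" if "T \<in> Th" for T
      using has_integral_integral_lebesgue_on g c(2) that full_polytopeD(6) by blast
    show "pairwise (\<lambda>S S'. negligible (S \<inter> S')) Th"
    proof (rule pairwiseI)
      fix S S' assume S: "S \<in> Th" "S' \<in> Th" "S \<noteq> S'"
      then have "S \<inter> S' \<subseteq> frontier S"
        using cells_eqI[OF m S(1,2)] closure_subset[of S] by (auto simp: frontier_def)
      then show "negligible (S \<inter> S')"
        using negligible_subset[OF negligible_convex_frontier] c(2)[OF S(1)] full_polytopeD(1) by blast
    qed
  qed
  then have "(g has_integral (\<Sum>T\<in>Th. integral\<^sup>L (lebesgue_on T) g)) \<Omega>"
    using has_integral_spike_set_eq[OF spike] c(3) by simp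
  then show "integral\<^sup>L (lebesgue_on \<Omega>) g = (\<Sum>T\<in>Th. integral\<^sup>L (lebesgue_on T) g)"
    using has_integral_integral_lebesgue_on[OF I \<Omega>] has_integral_unique by blast
qed

lemma glue_eq:
  assumes m: "simplicial_mesh \<Omega> (Th :: (real^'n) set set)" and T: "T \<in> Th" and x: "x \<in> interior T"
  shows "glue Th p x = p T x"
proof -
  have "(THE T. T \<in> Th \<and> x \<in> interior T) = T"
    using T x cells_eqI[OF m] interior_subset by (intro the_equality) blast+
  then show ?thesis using T x by (auto simp: glue_def)
qed

lemma glue_AE:
  assumes m: "simplicial_mesh \<Omega> (Th :: (real^'n) set set)" and T: "T \<in> Th"
  shows "AE x in lebesgue_on T. glue Th p x = p T x"
  using glue_eq[OF m T] by (intro AE_full_polytope_interior[OF mesh_cells(2)[OF m T]])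

text \<open>The slab around a compact face is compact, and integrating over the face means integrating
  the composition with the orthogonal projection over the slab.\<close>

lemma integrable_face_measure:
  fixes g :: "'a::euclidean_space \<Rightarrow> 'b::euclidean_space"
  assumes F: "compact F" "F \<noteq> {}" and g: "continuous_on UNIV g"
  shows "integrable (face_measure F) g"
proof -
  let ?c = "closest_point (affine hull F)"
  have cont: "continuous_on S ?c" for S
    using F by (intro continuous_on_closest_point) auto
  have "face_slab F = (?c -` F) \<inter> {x. dist x (?c x) \<le> 1 / 2}" by (auto simp: face_slab_def)
  moreover have "closed (?c -` F)" using F cont by (intro closed_vimage compact_imp_closed)
  moreover have "closed {x. dist x (?c x) \<le> 1 / 2}"
    by (intro closed_Collect_le continuous_intros cont)
  ultimately have cl: "closed (face_slab F)" by (simp add: closed_Int del: le_divide_eq_numeral1)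
  obtain R where R: "\<And>y. y \<in> F \<Longrightarrow> norm y \<le> R" using F by (meson bounded_iff compact_imp_bounded)
  have "norm x \<le> R + 1 / 2" if "x \<in> face_slab F" for x
  proof -
    have "norm (?c x) \<le> R" "dist x (?c x) \<le> 1 / 2" using that R by (auto simp: face_slab_def)
    then show ?thesis using norm_triangle_ineq2[of x "?c x"] by (simp add: dist_norm)
  qed
  then have comp: "compact (face_slab F)" using cl by (auto simp: compact_eq_bounded_closed bounded_iff)
  have "?c \<in> borel_measurable lebesgue"
    using borel_measurable_continuous_onI[OF cont] by (simp add: measurable_completion)
  then have meas: "?c \<in> borel_measurable (lebesgue_on (face_slab F))"
    by (rule measurable_restrict_space1)
  have "integrable (lebesgue_on (face_slab F)) (\<lambda>x. g (?c x))"
    using cont g by (intro integrable_lebesgue_on_compact comp) (auto intro: continuous_on_compose2)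
  then show ?thesis
    unfolding face_measure_def using meas borel_measurable_continuous_onI[OF g]
    by (subst integrable_distr_eq) auto
qed

section \<open>The weak gradient\<close>

text \<open>The map sending \<open>g\<close> to the combination of basis vectors \<open>b\<close> of \<open>S\<close> with coefficients
  \<open>B g b\<close> is injective on \<open>S\<close> by definiteness, hence onto \<open>S\<close> by dimension. A preimage of the
  combination with coefficients \<open>l b\<close> represents \<open>l\<close>.\<close>

lemma riesz_on_subspace:
  fixes B :: "'a::euclidean_space \<Rightarrow> 'a \<Rightarrow> real"
  assumes S: "subspace S" and lin1: "\<And>y. linear (\<lambda>x. B x y)" and lin2: "\<And>x. linear (B x)"
    and nondeg: "\<And>x. x \<in> S \<Longrightarrow> B x x = 0 \<Longrightarrow> x = 0" and l: "linear l"
  shows "\<exists>g\<in>S. \<forall>s\<in>S. B g s = l s"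
proof -
  obtain E where E: "E \<subseteq> S" "independent E" "span E = S"
    using orthonormal_basis_subspace[OF S] by metis
  have fin: "finite E" using E(2) independent_imp_finite by blast
  define \<phi> where "\<phi> g = (\<Sum>b\<in>E. B g b *\<^sub>R b)" for g
  have lphi: "linear \<phi>"
    unfolding \<phi>_def
    by (rule linearI)
      (simp_all add: linear_add[OF lin1] linear_cmul[OF lin1] sum.distrib scaleR_left_distrib scaleR_sum_right)
  have coeffs: "c b = d b" if "(\<Sum>b\<in>E. c b *\<^sub>R b) = (\<Sum>b\<in>E. d b *\<^sub>R b)" "b \<in> E" for c d b
  proof -
    have "(\<Sum>b\<in>E. (c b - d b) *\<^sub>R b) = 0" using that by (simp add: scaleR_diff_left sum_subtractf)
    then have "c b - d b = 0" using independentD[OF E(2) fin order.refl, of "\<lambda>b. c b - d b"] that by blast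
    then show ?thesis by simp
  qed
  have rep: "B g s = l' s" if "linear l'" "\<And>b. b \<in> E \<Longrightarrow> B g b = l' b" "s \<in> S" for g s l'
    using linear_eq_on_span[OF lin2 that(1), of E g s] that E by blast
  have "inj_on \<phi> S"
  proof (subst linear_injective_on_subspace_0[OF lphi S], safe)
    fix g assume g: "g \<in> S" "\<phi> g = 0"
    then have "B g b = 0" if "b \<in> E" for b
      using coeffs[of "B g" "\<lambda>_. 0"] that by (simp add: \<phi>_def)
    then have "B g g = 0" using rep[of "\<lambda>_. 0" g g] g by (simp add: linear_zero)
    then show "g = 0" using nondeg g by blast
  qed
  then have "dim (\<phi> ` S) = dim S"
    using lphi by (intro dim_image_eq) (simp_all add: span_eq_iff[THEN iffD2, OF S])
  moreover have "\<phi> ` S \<subseteq> S"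
    unfolding \<phi>_def using E(1) by (auto intro!: subspace_sum[OF S] subspace_scale[OF S])
  ultimately have "\<phi> ` S = S"
    using subspace_dim_equal[OF linear_subspace_image[OF lphi S] S] by simp
  moreover have "(\<Sum>b\<in>E. l b *\<^sub>R b) \<in> S"
    using E(1) by (auto intro!: subspace_sum[OF S] subspace_scale[OF S])
  ultimately obtain g where g: "g \<in> S" "\<phi> g = (\<Sum>b\<in>E. l b *\<^sub>R b)" by (metis imageE)
  then have "B g b = l b" if "b \<in> E" for b
    using coeffs[of "B g" l b] that by (simp add: \<phi>_def)
  then show ?thesis using rep[OF l] g by blast
qed

lemma linear_integral_inner:
  assumes lin: "\<And>x. linear (\<lambda>p. f p x)" and int: "\<And>p. integrable M (\<lambda>x. inner (f p x) (g x))"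
  shows "linear (\<lambda>p. LINT x|M. inner (f p x) (g x) :: real)"
  by (rule linearI)
    (simp_all add: linear_add[OF lin] linear_cmul[OF lin] inner_add_left int)

lemma L2_inner_commute: "L2_inner D f g = L2_inner D g f"
  by (simp add: L2_inner_def inner_commute)

lemma L2_inner_self_eq_0:
  fixes p :: "real^'n \<Rightarrow> 'b::euclidean_space"
  assumes T: "full_polytope T" and p: "p \<in> polys 1 UNIV" and z: "L2_inner T p p = 0"
  shows "p = (\<lambda>_. 0)"
proof -
  note cont = affine_poly_continuous[OF p]
  have "integrable (lebesgue_on T) (\<lambda>x. inner (p x) (p x))"
    by (intro integrable_lebesgue_on_compact full_polytopeD(2)[OF T] continuous_intros cont)
  then have "AE x in lebesgue_on T. inner (p x) (p x) = 0"
    using z unfolding L2_inner_def by (subst (asm) integral_nonneg_eq_0_iff_AE) auto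
  then have "AE x in lebesgue_on T. p x = 0" by simp
  moreover have "(\<lambda>_. 0) \<in> polys 1 (UNIV :: 'b set)"
    unfolding polys_1_iff by (intro exI[of _ "\<lambda>_. 0"] exI[of _ 0]) (simp add: linear_zero)
  ultimately show ?thesis using affine_polys_eq_AE[OF T p] by blast
qed

lemma tmulv_integrable_face:
  assumes T: "full_polytope T" "F facet_of T" and p: "p \<in> polys 1 UNIV"
  shows "integrable (face_measure F) (\<lambda>x. inner (tmulv (p x) n) c)"
proof -
  have "continuous_on UNIV (\<lambda>x. tmulv (p x) n)"
    by (rule linear_continuous_on_compose[OF affine_poly_continuous[OF p] linear_tmulv])
  then show ?thesis
    using facet_of_full_polytope[OF T] by (intro integrable_face_measure continuous_intros)
qed

text \<open>The definite description of the local weak gradient denotes: the inner product of the cell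
  is definite on the finite-dimensional local space, and the right-hand side is linear in the
  test function because \<open>\<tau>0\<close> is integrable and because affine functions are integrable over the
  compact facets.\<close>

lemma grad_w_loc_spec:
  fixes T :: "(real^'n) set"
  assumes T: "full_polytope T" and \<tau>0: "integrable (lebesgue_on T) \<tau>0"
  shows "grad_w_loc T \<tau>0 \<tau>b \<in> Sigma_loc \<and> (\<forall>\<Psi>\<in>Sigma_loc.
     L2_inner T (grad_w_loc T \<tau>0 \<tau>b) \<Psi> = - L2_inner T (div_tensor \<Psi>) \<tau>0 +
       (\<Sum>F | F facet_of T. face_inner F (\<lambda>x. tmulv (\<Psi> x) (outward_normal T F)) (\<lambda>_. \<tau>b F)))"
    (is "?G \<in> _ \<and> (\<forall>\<Psi>\<in>_. _ = ?l \<Psi>)")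
proof -
  let ?S = "Sym3 \<times> Sym :: ((real^'n^'n^'n) \<times> (real^'n^'n)) set"
  let ?B = "\<lambda>p q. L2_inner T (sigma_fun p) (sigma_fun q)"
  have S: "subspace ?S" by (intro subspace_Times subspace_Sym3 subspace_Sym)
  have lin: "linear (\<lambda>p. ?B p q)" for q
    unfolding L2_inner_def
    by (intro linear_integral_inner sigma_fun_linear integrable_lebesgue_on_compact full_polytopeD(2)[OF T]
        continuous_intros affine_poly_continuous sigma_fun_polys_1)
  have lin': "linear (?B p)" for p using lin[of p] by (subst L2_inner_commute)
  have nondeg: "p = 0" if "?B p p = 0" for p
    using L2_inner_self_eq_0[OF T sigma_fun_polys_1 that] sigma_fun_eq_0 by blast
  have l1: "linear (\<lambda>p. L2_inner T (div_tensor (sigma_fun p)) \<tau>0)"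
    unfolding div_sigma_fun L2_inner_def using \<tau>0
    by (intro linear_integral_inner) (auto intro!: linearI simp: algebra_simps)
  have l2: "linear (\<lambda>p. face_inner F (\<lambda>x. tmulv (sigma_fun p x) (outward_normal T F)) (\<lambda>_. \<tau>b F))"
    if "F facet_of T" for F
    unfolding face_inner_def
    using linear_compose[OF sigma_fun_linear linear_tmulv]
    by (intro linear_integral_inner tmulv_integrable_face[OF T that] sigma_fun_polys_1) (auto simp: o_def)
  have l: "linear (\<lambda>p. ?l (sigma_fun p))"
    by (intro linear_compose_add linear_compose_neg linear_compose_sum ballI l1) (auto intro: l2)
  obtain g where g: "g \<in> ?S" "\<forall>s\<in>?S. ?B g s = ?l (sigma_fun s)"
    using riesz_on_subspace[OF S lin lin' nondeg l] by blast
  let ?P = "\<lambda>G. G \<in> Sigma_loc \<and> (\<forall>\<Psi>\<in>Sigma_loc. L2_inner T G \<Psi> = ?l \<Psi>)"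
  have "?P (sigma_fun g)" using g unfolding Sigma_loc_eq by auto
  moreover have "G = sigma_fun g" if G: "?P G" for G
  proof -
    obtain q where q: "q \<in> ?S" "G = sigma_fun q" using G unfolding Sigma_loc_eq by auto
    have qg: "q - g \<in> ?S" using S q g subspace_diff by blast
    then have "?B q (q - g) = ?B g (q - g)" using G g q unfolding Sigma_loc_eq by auto
    then have "?B (q - g) (q - g) = 0" by (simp add: linear_diff[OF lin])
    then show ?thesis using nondeg q by fastforce
  qed
  ultimately show ?thesis unfolding grad_w_loc_def by (rule theI)
qed

lemma L2_inner_mesh:
  fixes f g :: "real^'n \<Rightarrow> 'b::euclidean_space"
  assumes m: "simplicial_mesh \<Omega> Th" and dom: "polytopal_domain \<Omega>"
    and f: "\<And>T. T \<in> Th \<Longrightarrow> continuous_on T (f' T)" "\<And>T. T \<in> Th \<Longrightarrow> AE x in lebesgue_on T. f x = f' T x"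
    and g: "\<And>T. T \<in> Th \<Longrightarrow> continuous_on T (g' T)" "\<And>T. T \<in> Th \<Longrightarrow> AE x in lebesgue_on T. g x = g' T x"
  shows "L2_inner \<Omega> f g = (\<Sum>T\<in>Th. L2_inner T (f' T) (g' T))"
proof -
  note c = mesh_cells[OF m]
  have "integrable (lebesgue_on T) (\<lambda>x. inner (f x) (g x))" if T: "T \<in> Th" for T
  proof (rule integrable_lebesgue_on_AE)
    show "AE x in lebesgue_on T. inner (f' T x) (g' T x) = inner (f x) (g x)"
      using f(2)[OF T] g(2)[OF T] by eventually_elim simp
    show "integrable (lebesgue_on T) (\<lambda>x. inner (f' T x) (g' T x))"
      by (intro integrable_lebesgue_on_compact full_polytopeD(2) c(2) T continuous_intros f(1) g(1))
  qed (rule full_polytopeD(6)[OF c(2)[OF T]])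
  then have "L2_inner \<Omega> f g = (\<Sum>T\<in>Th. L2_inner T f g)"
    unfolding L2_inner_def by (rule mesh_integral(2)[OF m dom])
  also have "\<dots> = (\<Sum>T\<in>Th. L2_inner T (f' T) (g' T))"
    using f(2) g(2) c(2) full_polytopeD(6) by (intro sum.cong L2_inner_cong_AE) auto
  finally show ?thesis .
qed

lemma Sigma_h_inv_piece:
  assumes m: "simplicial_mesh \<Omega> Th" and T: "T \<in> Th" and \<Psi>: "\<Psi> \<in> Sigma_h_inv \<Omega> Th"
  shows "piece T \<Psi> \<in> Sigma_loc" "AE x in lebesgue_on T. \<Psi> x = piece T \<Psi> x"
proof -
  obtain p where p: "p \<in> Sigma_loc" "AE x in lebesgue_on T. \<Psi> x = p x"
    using \<Psi> T by (auto simp: Sigma_h_inv_def restricts_to_def)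
  then have "piece T \<Psi> = p"
    using piece_eq[OF mesh_cells(2)[OF m T]] Sigma_loc_polys_1 by blast
  then show "piece T \<Psi> \<in> Sigma_loc" "AE x in lebesgue_on T. \<Psi> x = piece T \<Psi> x" using p by auto
qed

lemma eps_h_constant:
  assumes m: "simplicial_mesh \<Omega> Th" and T: "T \<in> Th" and w: "w \<in> V_h \<Omega> Th nF"
  shows "\<exists>e. AE x in lebesgue_on T. eps_h Th w x = e"
proof -
  obtain p where p: "p \<in> polys 1 UNIV" "AE x in lebesgue_on T. w x = p x"
    using w T by (auto simp: V_h_def restricts_to_def)
  then have "piece T w = p" using piece_eq[OF mesh_cells(2)[OF m T]] by blast
  then obtain e where "\<forall>x. sym_grad (piece T w) x = e"
    using sym_grad_affine_constant[OF p(1)] by blast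
  then show ?thesis using glue_AE[OF m T, of "\<lambda>T. sym_grad (piece T w)"] by (auto simp: eps_h_def)
qed

lemma grad_w_piece:
  assumes m: "simplicial_mesh \<Omega> (Th :: (real^'n) set set)" and T: "T \<in> Th" and w: "w \<in> V_h \<Omega> Th nF"
  shows "grad_w_loc T (eps_h Th w) \<xi> \<in> Sigma_loc"
    and "\<Psi> \<in> Sigma_loc \<Longrightarrow> L2_inner T (grad_w_loc T (eps_h Th w) \<xi>) \<Psi> =
      - L2_inner T (div_tensor \<Psi>) (eps_h Th w) +
       (\<Sum>F | F facet_of T. face_inner F (\<lambda>x. tmulv (\<Psi> x) (outward_normal T F)) (\<lambda>_. \<xi> F))"
proof -
  note sT = mesh_cells(2)[OF m T]
  obtain e where e: "AE x in lebesgue_on T. eps_h Th w x = e" using eps_h_constant[OF m T w] by blast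
  have "integrable (lebesgue_on T) (eps_h Th w)"
    by (rule integrable_lebesgue_on_AE[OF full_polytopeD(6)[OF sT] AE_sym[OF e]])
      (intro integrable_lebesgue_on_compact full_polytopeD(2)[OF sT] continuous_intros)
  from grad_w_loc_spec[OF sT this, of \<xi>]
  show "grad_w_loc T (eps_h Th w) \<xi> \<in> Sigma_loc"
    and "\<Psi> \<in> Sigma_loc \<Longrightarrow> L2_inner T (grad_w_loc T (eps_h Th w) \<xi>) \<Psi> =
      - L2_inner T (div_tensor \<Psi>) (eps_h Th w) +
       (\<Sum>F | F facet_of T. face_inner F (\<lambda>x. tmulv (\<Psi> x) (outward_normal T F)) (\<lambda>_. \<xi> F))"
    by blast+
qed

text \<open>Summing the local definitions of the weak gradient, each tested with the restriction of
  \<open>\<Psi>\<close> itself. Everything else rests on this identity: for every piecewise \<open>\<Psi>\<close>, only the boundary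
  terms separate the weak gradient from the negative adjoint of the elementwise divergence.\<close>

lemma weak_gradient_by_parts:
  assumes m: "simplicial_mesh \<Omega> Th" and dom: "polytopal_domain \<Omega>"
    and \<Psi>: "\<Psi> \<in> Sigma_h_inv \<Omega> Th" and w: "w \<in> V_h \<Omega> Th nF"
  shows "L2_inner \<Omega> \<Psi> (grad_w Th (eps_h Th w) \<xi>) = - L2_inner \<Omega> (div_h Th \<Psi>) (eps_h Th w) +
    (\<Sum>T\<in>Th. \<Sum>F | F facet_of T.
       face_inner F (\<lambda>x. tmulv (piece T \<Psi> x) (outward_normal T F)) (\<lambda>_. \<xi> F))"
proof -
  note c = mesh_cells[OF m]
  let ?G = "\<lambda>T. grad_w_loc T (eps_h Th w) \<xi>"
  note P = Sigma_h_inv_piece[OF m _ \<Psi>] and G = grad_w_piece[OF m _ w, where \<xi> = \<xi>]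
  obtain e where e: "\<And>T. T \<in> Th \<Longrightarrow> AE x in lebesgue_on T. eps_h Th w x = e T"
    using eps_h_constant[OF m _ w] by metis
  have dconst: "\<exists>d. div_tensor (piece T \<Psi>) = (\<lambda>_. d)" if "T \<in> Th" for T
    using P(1)[OF that] unfolding Sigma_loc_eq by (auto simp: div_sigma_fun)
  have "L2_inner \<Omega> \<Psi> (grad_w Th (eps_h Th w) \<xi>) = (\<Sum>T\<in>Th. L2_inner T (piece T \<Psi>) (?G T))"
    unfolding grad_w_def
    using P G(1) glue_AE[OF m]
    by (intro L2_inner_mesh[OF m dom] affine_poly_continuous Sigma_loc_polys_1) auto
  also have "\<dots> = (\<Sum>T\<in>Th. - L2_inner T (div_tensor (piece T \<Psi>)) (eps_h Th w) +
      (\<Sum>F | F facet_of T. face_inner F (\<lambda>x. tmulv (piece T \<Psi> x) (outward_normal T F)) (\<lambda>_. \<xi> F)))"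
    using P(1) G(2) by (intro sum.cong refl) (simp add: L2_inner_commute[of _ "piece _ \<Psi>"])
  also have "\<dots> = - (\<Sum>T\<in>Th. L2_inner T (div_tensor (piece T \<Psi>)) (eps_h Th w)) +
    (\<Sum>T\<in>Th. \<Sum>F | F facet_of T.
       face_inner F (\<lambda>x. tmulv (piece T \<Psi> x) (outward_normal T F)) (\<lambda>_. \<xi> F))"
    by (simp add: sum.distrib sum_negf sum_subtractf)
  also have "(\<Sum>T\<in>Th. L2_inner T (div_tensor (piece T \<Psi>)) (eps_h Th w)) =
      (\<Sum>T\<in>Th. L2_inner T (div_tensor (piece T \<Psi>)) (\<lambda>_. e T))"
    using c(2) full_polytopeD(6) e by (intro sum.cong L2_inner_cong_AE) auto
  also have "\<dots> = L2_inner \<Omega> (div_h Th \<Psi>) (eps_h Th w)"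
    unfolding div_h_def
  proof (rule L2_inner_mesh[OF m dom, symmetric])
    show "continuous_on T (div_tensor (piece T \<Psi>))" if "T \<in> Th" for T
      using dconst[OF that] by auto
  qed (use e glue_AE[OF m] in auto)
  finally show ?thesis .
qed

section \<open>Normal continuity\<close>

lemma Sigma_h_invI:
  assumes m: "simplicial_mesh \<Omega> Th" and dom: "polytopal_domain \<Omega>"
    and p: "\<And>T. T \<in> Th \<Longrightarrow> p T \<in> Sigma_loc" "\<And>T. T \<in> Th \<Longrightarrow> AE x in lebesgue_on T. \<Psi> x = p T x"
    and sym: "\<And>x. \<Psi> x \<in> Sym3"
  shows "\<Psi> \<in> Sigma_h_inv \<Omega> Th"
proof -
  note c = mesh_cells[OF m]
  have int: "integrable (lebesgue_on \<Omega>) (\<lambda>x. h (\<Psi> x))"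
    if h: "continuous_on UNIV h" for h :: "_ \<Rightarrow> 'c::euclidean_space"
  proof (rule mesh_integral(1)[OF m dom])
    fix T assume T: "T \<in> Th"
    show "integrable (lebesgue_on T) (\<lambda>x. h (\<Psi> x))"
    proof (rule integrable_lebesgue_on_AE)
      show "AE x in lebesgue_on T. h (p T x) = h (\<Psi> x)" using p(2)[OF T] by eventually_elim simp
      show "integrable (lebesgue_on T) (\<lambda>x. h (p T x))"
        by (intro integrable_lebesgue_on_compact full_polytopeD(2) c(2) T continuous_on_compose2[OF h]
            affine_poly_continuous Sigma_loc_polys_1 p(1) subset_UNIV)
    qed (rule full_polytopeD(6)[OF c(2)[OF T]])
  qed
  have "\<Psi> \<in> borel_measurable (lebesgue_on \<Omega>)"
    using int[of "\<lambda>y. y"] by (auto intro: borel_measurable_integrable)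
  moreover have "integrable (lebesgue_on \<Omega>) (\<lambda>x. (norm (\<Psi> x))\<^sup>2)"
    by (intro int continuous_intros)
  ultimately have "\<Psi> \<in> L2 \<Omega> Sym3" using sym by (simp add: L2_def)
  then show ?thesis using p unfolding Sigma_h_inv_def restricts_to_def by blast
qed

lemma sum_cells_facets_swap:
  assumes m: "simplicial_mesh \<Omega> (Th :: (real^'n) set set)"
  shows "(\<Sum>T\<in>Th. \<Sum>F | F facet_of T. X T F) = (\<Sum>F\<in>faces Th. \<Sum>T | T \<in> Th \<and> F facet_of T. X T F)"
proof -
  have "(\<Sum>T\<in>Th. \<Sum>F | F facet_of T. X T F) = (\<Sum>T\<in>Th. \<Sum>F\<in>{F \<in> faces Th. F facet_of T}. X T F)"
    by (intro sum.cong refl) (auto simp: faces_def)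
  also have "\<dots> = (\<Sum>F\<in>faces Th. \<Sum>T\<in>{T \<in> Th. F facet_of T}. X T F)"
    by (rule sum.swap_restrict[OF mesh_cells(1)[OF m] finite_faces[OF m]])
  finally show ?thesis .
qed

text \<open>The two outward normals are opposite, so the contributions of the two cells combine to the
  jump of the normal component.\<close>

lemma two_sided_face_sum:
  assumes m: "simplicial_mesh \<Omega> (Th :: (real^'n) set set)" and nF: "fixed_normals \<Omega> Th nF"
    and T: "T \<in> Th" "T' \<in> Th" "T \<noteq> T'" "F facet_of T" "F facet_of T'"
  shows "\<exists>s. (s = 1 \<or> s = -1) \<and>
    (\<Sum>T | T \<in> Th \<and> F facet_of T. face_inner F (\<lambda>x. tmulv (p T x) (outward_normal T F)) q) =
    s * (face_inner F (\<lambda>x. tmulv (p T x) (nF F)) q - face_inner F (\<lambda>x. tmulv (p T' x) (nF F)) q)"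
proof -
  obtain s where s: "s = 1 \<or> s = -1" "outward_normal T F = s *\<^sub>R nF F"
    using fixed_normal_sign[OF m nF T(1,4)] by blast
  then have s': "outward_normal T' F = (- s) *\<^sub>R nF F"
    using shared_facet_opposite_normals[OF m T] by simp
  have scale: "face_inner F (\<lambda>x. tmulv (r x) (c *\<^sub>R n)) q = c * face_inner F (\<lambda>x. tmulv (r x) n) q" for r c n
    by (simp add: face_inner_def tmulv_scaleR_right)
  have "(\<Sum>T | T \<in> Th \<and> F facet_of T. face_inner F (\<lambda>x. tmulv (p T x) (outward_normal T F)) q) =
    s * (face_inner F (\<lambda>x. tmulv (p T x) (nF F)) q - face_inner F (\<lambda>x. tmulv (p T' x) (nF F)) q)"
    unfolding cells_at_shared_facet[OF m T] using T(3) s(2) s' scale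
    by (simp add: right_diff_distrib del: scaleR_minus_left)
  with s(1) show ?thesis by blast
qed

lemma face_inner_zero_right: "face_inner F f (\<lambda>_. 0) = 0"
  by (simp add: face_inner_def)

text \<open>Face data vanish on boundary faces; on an interior face, which has two cells, the
  contributions cancel by normal continuity.\<close>

lemma Sigma_h_face_sum:
  assumes m: "simplicial_mesh \<Omega> (Th :: (real^'n) set set)" and dom: "polytopal_domain \<Omega>"
    and nF: "fixed_normals \<Omega> Th nF" and \<Psi>: "\<Psi> \<in> Sigma_h \<Omega> Th nF" and \<xi>: "\<xi> \<in> P0_int_faces \<Omega> Th"
  shows "(\<Sum>T\<in>Th. \<Sum>F | F facet_of T.
    face_inner F (\<lambda>x. tmulv (piece T \<Psi> x) (outward_normal T F)) (\<lambda>_. \<xi> F)) = 0"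
proof -
  have "(\<Sum>T | T \<in> Th \<and> F facet_of T.
    face_inner F (\<lambda>x. tmulv (piece T \<Psi> x) (outward_normal T F)) (\<lambda>_. \<xi> F)) = 0" if F: "F \<in> faces Th" for F
  proof (cases "F \<in> interior_faces \<Omega> Th")
    case True
    then obtain T T' where T: "T \<in> Th" "T' \<in> Th" "T \<noteq> T'" "F facet_of T" "F facet_of T'"
      using interior_face_shared[OF m dom] by blast
    have "(\<lambda>_. \<xi> F) \<in> polys 0 Sym" unfolding polys_0 using \<xi> F by (auto simp: P0_int_faces_def)
    then have "face_inner F (\<lambda>x. tmulv (piece T \<Psi> x) (nF F)) (\<lambda>_. \<xi> F) =
       face_inner F (\<lambda>x. tmulv (piece T' \<Psi> x) (nF F)) (\<lambda>_. \<xi> F)"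
      using \<Psi> True T unfolding Sigma_h_def by blast
    then show ?thesis using two_sided_face_sum[OF m nF T, of "\<lambda>T. piece T \<Psi>" "\<lambda>_. \<xi> F"] by auto
  next
    case False
    then have "\<xi> F = 0" using \<xi> F by (auto simp: P0_int_faces_def)
    then show ?thesis by (simp add: face_inner_zero_right)
  qed
  then show ?thesis unfolding sum_cells_facets_swap[OF m] by simp
qed

text \<open>Face data supported on a single interior face isolate the jump of the normal component
  there. If \<open>T\<close> and \<open>T'\<close> are distinct cells with facet \<open>F\<close>, they are all the cells at \<open>F\<close>.\<close>

lemma Sigma_hI:
  assumes m: "simplicial_mesh \<Omega> (Th :: (real^'n) set set)"
    and nF: "fixed_normals \<Omega> Th nF" and \<Psi>: "\<Psi> \<in> Sigma_h_inv \<Omega> Th"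
    and test: "\<And>\<xi>. \<xi> \<in> P0_int_faces \<Omega> Th \<Longrightarrow> (\<Sum>T\<in>Th. \<Sum>F | F facet_of T.
      face_inner F (\<lambda>x. tmulv (piece T \<Psi> x) (outward_normal T F)) (\<lambda>_. \<xi> F)) = 0"
  shows "\<Psi> \<in> Sigma_h \<Omega> Th nF"
  unfolding Sigma_h_def
proof (intro CollectI conjI ballI impI \<Psi>)
  fix F T T' and q :: "real^'n \<Rightarrow> real^'n^'n"
  assume F: "F \<in> interior_faces \<Omega> Th" and q: "q \<in> polys 0 Sym"
    and T: "T \<in> Th" "T' \<in> Th" "F facet_of T" "F facet_of T'"
  show "face_inner F (\<lambda>x. tmulv (piece T \<Psi> x) (nF F)) q = face_inner F (\<lambda>x. tmulv (piece T' \<Psi> x) (nF F)) q"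
  proof (cases "T = T'")
    case False
    obtain c where c: "c \<in> Sym" "q = (\<lambda>_. c)" using q unfolding polys_0 by blast
    define \<xi> where "\<xi> G = (if G = F then c else 0)" for G
    have Ff: "F \<in> faces Th" using F by (simp add: interior_faces_def)
    have "\<xi> \<in> P0_int_faces \<Omega> Th"
      using F c by (auto simp: P0_int_faces_def \<xi>_def subspace_0[OF subspace_Sym])
    from test[OF this] have "0 = (\<Sum>G\<in>faces Th. \<Sum>T | T \<in> Th \<and> G facet_of T.
      face_inner G (\<lambda>x. tmulv (piece T \<Psi> x) (outward_normal T G)) (\<lambda>_. \<xi> G))"
      unfolding sum_cells_facets_swap[OF m] by (rule sym)
    also have "\<dots> = (\<Sum>G\<in>faces Th. if G = F then \<Sum>T | T \<in> Th \<and> F facet_of T.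
      face_inner F (\<lambda>x. tmulv (piece T \<Psi> x) (outward_normal T F)) q else 0)"
      by (rule sum.cong) (auto simp: \<xi>_def c face_inner_zero_right)
    also have "\<dots> = (\<Sum>T | T \<in> Th \<and> F facet_of T.
      face_inner F (\<lambda>x. tmulv (piece T \<Psi> x) (outward_normal T F)) q)"
      using Ff finite_faces[OF m] by (simp add: sum.delta)
    finally show ?thesis
      using two_sided_face_sum[OF m nF T(1,2) False T(3,4), of "\<lambda>T. piece T \<Psi>" q] by auto
  qed simp
qed

section \<open>The mixed method\<close>

theorem theorem4p2:
  fixes \<Omega> :: "(real^'n) set" and Th :: "(real^'n) set set" and nF :: "(real^'n) set \<Rightarrow> real^'n"
    and \<kappa> \<mu> lam \<iota> :: real
    and f u :: "real^'n \<Rightarrow> real^'n" and \<eta> :: "(real^'n) set \<Rightarrow> real^'n^'n"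
    and \<Phi> :: "real^'n \<Rightarrow> real^'n^'n^'n"
  assumes "2 \<le> CARD('n)"
    and "polytopal_domain \<Omega>"
    and "0 < \<mu>" and "0 < lam" and "0 < \<iota>" and "\<iota> \<le> 1"
    and "f \<in> L2 \<Omega> UNIV"
    and "simplicial_mesh \<Omega> Th" and "0 < \<kappa>" and "shape_regular \<kappa> Th"
    and "fixed_normals \<Omega> Th nF"
    and "u \<in> V_h \<Omega> Th nF" and "\<eta> \<in> P0_int_faces \<Omega> Th"
    and "\<forall>v\<in>V_h \<Omega> Th nF. \<forall>\<xi>\<in>P0_int_faces \<Omega> Th.
      \<iota>\<^sup>2 * L2_inner \<Omega> (\<lambda>x. Ctil \<mu> lam (grad_w Th (eps_h Th u) \<eta> x)) (grad_w Th (eps_h Th v) \<xi>)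
        + c_h \<mu> lam \<Omega> Th nF u v = L2_inner \<Omega> f v"
    and "\<Phi> = (\<lambda>x. \<iota>\<^sup>2 *\<^sub>R Ctil \<mu> lam (grad_w Th (eps_h Th u) \<eta> x))"
  shows "\<Phi> \<in> Sigma_h \<Omega> Th nF \<and>
    (\<forall>\<Psi>\<in>Sigma_h \<Omega> Th nF.
      (1 / \<iota>\<^sup>2) * L2_inner \<Omega> (\<lambda>x. Atil \<mu> lam (\<Phi> x)) \<Psi>
        + L2_inner \<Omega> (div_h Th \<Psi>) (eps_h Th u) = 0) \<and>
    (\<forall>v\<in>V_h \<Omega> Th nF.
      L2_inner \<Omega> (div_h Th \<Phi>) (eps_h Th v) - c_h \<mu> lam \<Omega> Th nF u v = - L2_inner \<Omega> f v)"
proof -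
  note dom = assms(2) and m = assms(8) and nF = assms(11) and u = assms(12) and \<eta> = assms(13)
    and method' = assms(14) and \<Phi> = assms(15)
  let ?g = "grad_w Th (eps_h Th u) \<eta>"
  let ?p = "\<lambda>T x. \<iota>\<^sup>2 *\<^sub>R Ctil \<mu> lam (grad_w_loc T (eps_h Th u) \<eta> x)"
  let ?face = "\<lambda>\<Psi> \<xi>. \<Sum>T\<in>Th. \<Sum>F | F facet_of T.
       face_inner F (\<lambda>x. tmulv (piece T \<Psi> x) (outward_normal T F)) (\<lambda>_. \<xi> F)"
  have p: "?p T \<in> Sigma_loc" if "T \<in> Th" for T
    using Ctil_Sigma_loc[OF grad_w_piece(1)[OF m that u]] .
  have \<Phi>_inv: "\<Phi> \<in> Sigma_h_inv \<Omega> Th"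
  proof (rule Sigma_h_invI[OF m dom p])
    show "AE x in lebesgue_on T. \<Phi> x = ?p T x" if "T \<in> Th" for T
      using glue_AE[OF m that, of "\<lambda>T. grad_w_loc T (eps_h Th u) \<eta>"] unfolding \<Phi> grad_w_def
      by eventually_elim simp
    show "\<Phi> x \<in> Sym3" for x
    proof (cases "\<exists>T\<in>Th. x \<in> interior T")
      case True
      then obtain T where T: "T \<in> Th" "x \<in> interior T" by blast
      then have "\<Phi> x = ?p T x" by (simp add: \<Phi> grad_w_def glue_eq[OF m])
      then show ?thesis using Sigma_loc_Sym3[OF p[OF T(1)], of x] by (simp only:)
    next
      case False
      then show ?thesis
        by (simp add: \<Phi> grad_w_def glue_def linear_0[OF linear_Ctil] subspace_0[OF subspace_Sym3])
    qed
  qed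
  have scheme: "L2_inner \<Omega> \<Phi> (grad_w Th (eps_h Th v) \<xi>) + c_h \<mu> lam \<Omega> Th nF u v = L2_inner \<Omega> f v"
    if "v \<in> V_h \<Omega> Th nF" "\<xi> \<in> P0_int_faces \<Omega> Th" for v \<xi>
  proof -
    have "L2_inner \<Omega> \<Phi> G = \<iota>\<^sup>2 * L2_inner \<Omega> (\<lambda>x. Ctil \<mu> lam (?g x)) G" for G
      by (simp add: \<Phi> L2_inner_def)
    then show ?thesis using method' that by (simp only:)
  qed
  have zero: "(\<lambda>_. 0) \<in> P0_int_faces \<Omega> Th"
    by (simp add: P0_int_faces_def subspace_0[OF subspace_Sym])
  have face0: "?face \<Psi> (\<lambda>_. 0) = 0" for \<Psi> by (simp add: face_inner_zero_right)
  note parts = weak_gradient_by_parts[OF m dom]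
  have "\<Phi> \<in> Sigma_h \<Omega> Th nF"
  proof (rule Sigma_hI[OF m nF \<Phi>_inv])
    fix \<xi> assume \<xi>: "\<xi> \<in> P0_int_faces \<Omega> Th"
    \<comment> \<open>The tests \<open>(u, \<xi>)\<close> and \<open>(u, 0)\<close> have the same load, \<open>c_h\<close> and divergence terms, so their difference is the face sum.\<close>
    show "?face \<Phi> \<xi> = 0"
      using scheme[OF u \<xi>] scheme[OF u zero] parts[OF \<Phi>_inv u, of \<xi>] parts[OF \<Phi>_inv u, of "\<lambda>_. 0"] face0[of \<Phi>]
      by linarith
  qed
  moreover have "(1 / \<iota>\<^sup>2) * L2_inner \<Omega> (\<lambda>x. Atil \<mu> lam (\<Phi> x)) \<Psi> + L2_inner \<Omega> (div_h Th \<Psi>) (eps_h Th u) = 0"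
    if \<Psi>: "\<Psi> \<in> Sigma_h \<Omega> Th nF" for \<Psi>
  proof -
    have "Atil \<mu> lam (\<Phi> x) = \<iota>\<^sup>2 *\<^sub>R ?g x" for x
      by (simp add: \<Phi> linear_cmul[OF linear_Atil] Atil_Ctil assms(3,4))
    then have "(1 / \<iota>\<^sup>2) * L2_inner \<Omega> (\<lambda>x. Atil \<mu> lam (\<Phi> x)) \<Psi> = L2_inner \<Omega> ?g \<Psi>"
      using assms(5) by (simp add: L2_inner_def)
    also have "\<dots> = L2_inner \<Omega> \<Psi> ?g" by (rule L2_inner_commute)
    also have "\<dots> = - L2_inner \<Omega> (div_h Th \<Psi>) (eps_h Th u)"
      using parts[OF _ u, of \<Psi> \<eta>] Sigma_h_face_sum[OF m dom nF \<Psi> \<eta>] \<Psi> by (simp add: Sigma_h_def)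
    finally show ?thesis by simp
  qed
  moreover have "L2_inner \<Omega> (div_h Th \<Phi>) (eps_h Th v) - c_h \<mu> lam \<Omega> Th nF u v = - L2_inner \<Omega> f v"
    if v: "v \<in> V_h \<Omega> Th nF" for v
    using scheme[OF v zero] parts[OF \<Phi>_inv v, of "\<lambda>_. 0"] face0[of \<Phi>] by linarith
  ultimately show ?thesis by blast
qed

end
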